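(* Let $d,n\ge 1$ be integers and let $1\le p\le\infty$. Let $L$ be an $n$-dimensional complex nilpotent Lie subalgebra of $\mathcal{L}(\mathbb{C}^d)^{op}$, and let $\{x_i\}_{1\le i\le n}$ be a Jordan-Hölder basis of $L$. Then $$\varrho_p((x_i)_{1\le i\le n})=r_p((x_i)_{1\le i\le n}).$$ Moreover, if $T=(T_1,\ldots,T_n)$ is an $n$-tuple of pairwise commuting $d\times d$ complex matrices, then $$\varrho_p(T)=r_p(T).$$
   Context: $\mathcal{L}(\mathbb{C}^d)$ is the algebra of all linear transformations of $\mathbb{C}^d$, identified with the $d\times d$ complex matrices, and $\mathcal{L}(\mathbb{C}^d)^{op}$ is the same vector space with the opposite product; it is a Lie algebra under the commutator of that product. Jordan-Hölder basis: let $L$ be a complex nilpotent Lie algebra of dimension $n$, and let $L^2$ denote the span of the brackets $[x,y]$, $x,y\in L$. There is a sequence of ideals $\{0\}=L_0\subseteq L_1\subseteq\cdots\subseteq L_n=L$ such that $\dim L_i=i$ for each $i$, $L_k=L^2$ for some $0\le k\le n$, and $[L_i,L_j]\subseteq L_{i-1}$ whenever $1\le i<j\le n$. A basis $\{x_j\}_{1\le j\le n}$ of $L$ is a Jordan-Hölder basis if, for some such sequence, $\{x_j\}_{1\le j\le i}$ is a basis of $L_i$ for each $i$. Joint point spectrum: for an $n$-tuple $T=(T_1,\ldots,T_n)$ of $d\times d$ complex matrices, $\sigma_{pt}(T)$ is the set of $\lambda=(\lambda_1,\ldots,\lambda_n)\in\mathbb{C}^n$ for which there is a nonzero $x\in\mathbb{C}^d$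 with $T_i(x)=\lambda_i x$ for all $1\le i\le n$. Norms: $\|x\|_p$ is the usual $p$-norm on $\mathbb{C}^d$ and $|\lambda|_p$ the usual $p$-norm on $\mathbb{C}^n$ ($1\le p\le\infty$). For an $N$-tuple $S=(S_1,\ldots,S_N)$ of $d\times d$ complex matrices, $\|S\|_p=\sup_{\|x\|_p\le1}\left(\sum_{j=1}^N\|S_j(x)\|_p^p\right)^{1/p}$ for $1\le p<\infty$, and $\|S\|_\infty=\sup_{\|x\|_\infty\le1}\max_{1\le j\le N}\|S_j(x)\|_\infty$. Geometric spectral radius: $r_p(T)=\max\{|\lambda|_p:\lambda\in\sigma_{pt}(T)\}$. Algebraic spectral radius: for an integer $m\ge1$, $T^m$ denotes the $n^m$-tuple of all products $T_{i_1}\cdots T_{i_m}$, $1\le i_1,\ldots,i_m\le n$ (repetitions allowed, indices arranged lexicographically), and $\varrho_p(T)=\inf_{m\ge1}\|T^m\|_p^{1/m}$. *)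

theory Defs
  imports "HOL-Analysis.Analysis"
begin

text \<open>
  The algebra of linear transformations of \<open>\<complex>\<^sup>d\<close> is the type \<open>complex^'d^'d\<close>, with \<open>d = CARD('d)\<close>.
  Its library vector space structure is real, so the complex one is introduced here; the prefix
  \<open>cmat\<close> then gives complex subspaces, spans, independence and dimension.
  Finite tuples of matrices or scalars are lists, so \<open>T\<^sub>i\<close> is \<open>T ! (i - 1)\<close>.
\<close>

definition mat_scale :: "complex \<Rightarrow> complex^'d^'d \<Rightarrow> complex^'d^'d"
  where "mat_scale c A = (\<chi> i j. c * A $ i $ j)"

interpretation cmat: vector_space mat_scale
  by unfold_locales (simp_all add: mat_scale_def vec_eq_iff algebra_simps)


definition op_mult :: "complex^'d^'d \<Rightarrow> complex^'d^'d \<Rightarrow> complex^'d^'d"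
  where "op_mult A B = B ** A"

definition op_bracket :: "complex^'d^'d \<Rightarrow> complex^'d^'d \<Rightarrow> complex^'d^'d"
  where "op_bracket A B = op_mult A B - op_mult B A"

definition bracket_span :: "(complex^'d^'d) set \<Rightarrow> (complex^'d^'d) set \<Rightarrow> (complex^'d^'d) set"
  where "bracket_span A B = cmat.span {op_bracket x y | x y. x \<in> A \<and> y \<in> B}"

definition lie_subalgebra :: "(complex^'d^'d) set \<Rightarrow> bool"
  where "lie_subalgebra L \<longleftrightarrow> cmat.subspace L \<and> (\<forall>x\<in>L. \<forall>y\<in>L. op_bracket x y \<in> L)"

definition lie_ideal :: "(complex^'d^'d) set \<Rightarrow> (complex^'d^'d) set \<Rightarrow> bool"
  where "lie_ideal I L \<longleftrightarrow>
    cmat.subspace I \<and> I \<subseteq> L \<and> (\<forall>x\<in>L. \<forall>y\<in>I. op_bracket x y \<in> I)"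

primrec lower_central :: "(complex^'d^'d) set \<Rightarrow> nat \<Rightarrow> (complex^'d^'d) set" where
  "lower_central L 0 = L"
| "lower_central L (Suc k) = bracket_span L (lower_central L k)"

definition lie_nilpotent :: "(complex^'d^'d) set \<Rightarrow> bool"
  where "lie_nilpotent L \<longleftrightarrow> (\<exists>k. lower_central L k = {0})"

definition jordan_hoelder_series ::
    "nat \<Rightarrow> (complex^'d^'d) set \<Rightarrow> (nat \<Rightarrow> (complex^'d^'d) set) \<Rightarrow> bool"
  where "jordan_hoelder_series n L F \<longleftrightarrow>
    F 0 = {0} \<and> F n = L \<and>
    (\<forall>i<n. F i \<subseteq> F (Suc i)) \<and>
    (\<forall>i\<le>n. lie_ideal (F i) L \<and> cmat.dim (F i) = i) \<and>
    (\<exists>k\<le>n. F k = bracket_span L L) \<and>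
    (\<forall>i j. 1 \<le> i \<and> i < j \<and> j \<le> n \<longrightarrow> bracket_span (F i) (F j) \<subseteq> F (i - 1))"

definition is_basis :: "(complex^'d^'d) list \<Rightarrow> (complex^'d^'d) set \<Rightarrow> bool"
  where "is_basis xs V \<longleftrightarrow>
    distinct xs \<and> cmat.independent (set xs) \<and> cmat.span (set xs) = V"

definition jordan_hoelder_basis ::
    "nat \<Rightarrow> (complex^'d^'d) set \<Rightarrow> (complex^'d^'d) list \<Rightarrow> bool"
  where "jordan_hoelder_basis n L xs \<longleftrightarrow>
    length xs = n \<and>
    (\<exists>F. jordan_hoelder_series n L F \<and> (\<forall>i\<le>n. is_basis (take i xs) (F i)))"


text \<open>The \<open>p\<close>-norm of a finite nonempty family, for \<open>1 \<le> p \<le> \<infinity>\<close>.\<close>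

definition pnorm :: "ennreal \<Rightarrow> 'i set \<Rightarrow> ('i \<Rightarrow> 'a::real_normed_vector) \<Rightarrow> real"
  where "pnorm p I f =
    (if p = \<infinity> then Max ((\<lambda>i. norm (f i)) ` I)
     else (\<Sum>i\<in>I. norm (f i) powr enn2real p) powr (1 / enn2real p))"

definition vec_pnorm :: "ennreal \<Rightarrow> complex^'d \<Rightarrow> real"
  where "vec_pnorm p x = pnorm p UNIV (\<lambda>i. x $ i)"

definition tuple_pnorm :: "ennreal \<Rightarrow> complex list \<Rightarrow> real"
  where "tuple_pnorm p l = pnorm p {..<length l} (\<lambda>i. l ! i)"

definition op_pnorm :: "ennreal \<Rightarrow> (complex^'d^'d) list \<Rightarrow> real"
  where "op_pnorm p S =
    (SUP x\<in>{x. vec_pnorm p x \<le> 1}. pnorm p {..<length S} (\<lambda>j. vec_pnorm p (S ! j *v x)))"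


definition joint_point_spectrum :: "(complex^'d^'d) list \<Rightarrow> complex list set"
  where "joint_point_spectrum T =
    {l. length l = length T \<and> (\<exists>x. x \<noteq> 0 \<and> (\<forall>i<length T. T ! i *v x = l ! i *s x))}"

definition geometric_spectral_radius :: "ennreal \<Rightarrow> (complex^'d^'d) list \<Rightarrow> real"
  where "geometric_spectral_radius p T = Max (tuple_pnorm p ` joint_point_spectrum T)"

text \<open>\<^const>\<open>product_lists\<close> enumerates lexicographically, by position in \<open>T\<close>.\<close>

definition tuple_power :: "(complex^'d^'d) list \<Rightarrow> nat \<Rightarrow> (complex^'d^'d) list"
  where "tuple_power T m = map (\<lambda>Ts. foldr (**) Ts (mat 1)) (product_lists (replicate m T))"

definition algebraic_spectral_radius :: "ennreal \<Rightarrow> (complex^'d^'d) list \<Rightarrow> real"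
  where "algebraic_spectral_radius p T = (INF m\<in>{1..}. root m (op_pnorm p (tuple_power T m)))"

end

theory Submission
  imports Defs "HOL-Computational_Algebra.Fundamental_Theorem_Algebra"
begin

text \<open>
  In both situations the matrices \<open>T\<^sub>1, \<dots>, T\<^sub>n\<close> satisfy
  \<open>[T\<^sub>i, T\<^sub>j] \<in> span {T\<^sub>1, \<dots>, T\<^bsub>i-1\<^esub>}\<close> for \<open>i < j\<close>; for commuting matrices the bracket vanishes.
  Such a tuple is treated as a family closed under a strictly descending bracket, and everything
  is proved for these tuples (\<open>spectral_radii_eq\<close>).

  The algebraic part is the representation theory of nilpotent Lie algebras, reduced to what the
  descending brackets give directly. First, a Lie theorem relative to an invariant subspace \<open>W\<close>:
  every invariant subspace not contained in \<open>W\<close> has a vector outside \<open>W\<close> that is a simultaneous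
  eigenvector modulo \<open>W\<close> (\<open>ex_weight_vector_mod\<close>). One imposes the eigenvalue equations for
  \<open>T\<^sub>1, T\<^sub>2, \<dots>\<close> in turn; the next eigenspace stays invariant because the relevant commutators act as
  scalars, and a commutator that acts as a scalar acts as zero. Secondly, the eigenvalues modulo \<open>W\<close>
  found in this way are eigenvalues of an honest joint eigenvector
  (\<open>weight_mod_imp_joint_weight\<close>): the generalised eigenspaces of each \<open>T\<^sub>i\<close> are invariant under
  the whole tuple, so one can restrict to their intersection, where only one weight is possible.
  Hence \<open>T\<close> has a simultaneous triangular form whose diagonals all lie in the joint point spectrum,
  and rescaling the basis vectors makes the off-diagonal entries arbitrarily small
  (\<open>ex_almost_diagonalisation\<close>).

  The analytic part compares this form with the tuple \<open>T\<^sup>m\<close>. In the \<open>p\<close>-norm of the adapted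
  coordinates a diagonal tuple maps \<open>y\<close> to a family of norm at most \<open>r\<^sub>p(T) \<parallel>y\<parallel>\<close>, since coordinate
  \<open>k\<close> is multiplied by the spectral point \<open>\<lambda>\<^sup>(\<^sup>k\<^sup>)\<close> of length at most \<open>r\<^sub>p(T)\<close>. So for each
  \<open>R > r\<^sub>p(T)\<close> suitable coordinates give a one-step bound by \<open>R\<close> (\<open>ex_contracting_norm\<close>), which
  iterates to \<open>R\<^sup>m\<close>; changing coordinates costs a constant, and its \<open>m\<close>-th root tends to \<open>1\<close>.
  Conversely a joint eigenvector for a spectral point \<open>\<lambda>\<close> is stretched by \<open>T\<^sup>m\<close> by exactly
  \<open>|\<lambda>|\<^sub>p\<^sup>m\<close> (\<open>tuple_power_eigenvector\<close>), so no power can have a smaller norm than \<open>r\<^sub>p(T)\<^sup>m\<close>.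
\<close>

section \<open>Polynomials in a matrix and eigenvectors modulo a subspace\<close>

text \<open>
  Matrix multiplication is not the ring multiplication of the type of matrices, so the value
  \<open>p(A) v\<close> is written out; acting on a vector rather than forming the matrix \<open>p(A)\<close> suits the arguments
  modulo a subspace below.
\<close>

definition poly_act :: "complex poly \<Rightarrow> complex^'d^'d \<Rightarrow> complex^'d \<Rightarrow> complex^'d"
  where "poly_act p A v = (\<Sum>i\<le>degree p. coeff p i *s (((*v) A ^^ i) v))"

lemma poly_act_degree_le:
  assumes "degree p \<le> N"
  shows "poly_act p A v = (\<Sum>i\<le>N. coeff p i *s (((*v) A ^^ i) v))"
  unfolding poly_act_def
  by (rule sum.mono_neutral_left) (use assms in \<open>auto simp: coeff_eq_0\<close>)

lemma poly_act_0 [simp]: "poly_act 0 A v = 0"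
  by (simp add: poly_act_def)

lemma poly_act_pCons [simp]: "poly_act (pCons a p) A v = a *s v + A *v poly_act p A v"
proof -
  have "poly_act (pCons a p) A v =
      (\<Sum>i\<le>Suc (degree p). coeff (pCons a p) i *s (((*v) A ^^ i) v))"
    by (rule poly_act_degree_le) (rule degree_pCons_le)
  also have "\<dots> = a *s v + (\<Sum>i\<le>degree p. coeff p i *s (A *v (((*v) A ^^ i) v)))"
    by (simp add: sum.atMost_Suc_shift del: sum.atMost_Suc)
  also have "(\<Sum>i\<le>degree p. coeff p i *s (A *v (((*v) A ^^ i) v))) = A *v poly_act p A v"
    by (simp add: poly_act_def vec.sum vector_scalar_commute matrix_vector_mul_linear_gen
        vec.linear_sum[OF matrix_vector_mul_linear_gen])
  finally show ?thesis .
qed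

lemma poly_act_1 [simp]: "poly_act 1 A v = v"
  by (simp add: one_pCons)

lemma poly_act_add: "poly_act (p + q) A v = poly_act p A v + poly_act q A v"
  by (induction p q rule: poly_induct2)
     (simp_all add: vec.scale_left_distrib matrix_vector_right_distrib)

lemma poly_act_smult: "poly_act (smult c p) A v = c *s poly_act p A v"
  by (induction p) (simp_all add: vector_add_ldistrib vector_smult_assoc vector_scalar_commute)

lemma poly_act_mult: "poly_act (p * q) A v = poly_act p A (poly_act q A v)"
  by (induction p) (simp_all add: poly_act_add poly_act_smult)

lemma poly_act_vec_add: "poly_act p A (v + w) = poly_act p A v + poly_act p A w"
  by (induction p) (simp_all add: vector_add_ldistrib matrix_vector_right_distrib)

lemma poly_act_vec_scale: "poly_act p A (c *s v) = c *s poly_act p A v"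
  by (induction p)
     (simp_all add: vector_add_ldistrib vector_smult_assoc vector_scalar_commute mult.commute)

lemma poly_act_vec_0 [simp]: "poly_act p A 0 = 0"
  using poly_act_vec_scale[of p A 0 0] by simp

definition invariant_subspace :: "(complex^'d^'d) set \<Rightarrow> (complex^'d) set \<Rightarrow> bool"
  where "invariant_subspace S W \<longleftrightarrow> vec.subspace W \<and> (\<forall>A\<in>S. \<forall>v\<in>W. A *v v \<in> W)"

lemma subspace_scale_iff:
  fixes v :: "complex^'d"
  assumes "vec.subspace W" "c \<noteq> 0"
  shows "c *s v \<in> W \<longleftrightarrow> v \<in> W"
proof
  assume "c *s v \<in> W"
  from vec.subspace_scale[OF assms(1) this, of "inverse c"] show "v \<in> W"
    using assms(2) by (simp add: vector_smult_assoc)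
qed (rule vec.subspace_scale[OF assms(1)])

lemma invariant_subspaceD:
  assumes "invariant_subspace S W"
  shows "vec.subspace W" "A \<in> S \<Longrightarrow> v \<in> W \<Longrightarrow> A *v v \<in> W"
  using assms by (auto simp: invariant_subspace_def)

lemma poly_act_in_subspace:
  assumes "invariant_subspace S W" "A \<in> S" "v \<in> W"
  shows "poly_act p A v \<in> W"
  by (induction p)
     (use assms in \<open>auto simp: invariant_subspace_def intro: vec.subspace_add vec.subspace_scale
        vec.subspace_0\<close>)

text \<open>
  On a vector that is an eigenvector modulo \<open>W\<close>, a polynomial in \<open>A\<close> acts modulo \<open>W\<close> through its value
  at the eigenvalue. This links polynomials vanishing on \<open>A\<close> to possible eigenvalues.
\<close>

lemma poly_act_eigen_mod:
  assumes W: "invariant_subspace S W" "A \<in> S" and eig: "A *v v - \<mu> *s v \<in> W"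
  shows "poly_act p A v - poly p \<mu> *s v \<in> W"
proof (induction p)
  case 0
  then show ?case using W by (simp add: invariant_subspace_def vec.subspace_0)
next
  case (pCons a p)
  have "poly_act (pCons a p) A v - poly (pCons a p) \<mu> *s v =
      A *v (poly_act p A v - poly p \<mu> *s v) + poly p \<mu> *s (A *v v - \<mu> *s v)"
    by (simp add: vec_eq_iff matrix_vector_mult_diff_distrib vector_scalar_commute algebra_simps)
  moreover have "A *v (poly_act p A v - poly p \<mu> *s v) \<in> W"
    using pCons W by (auto simp only: invariant_subspace_def)
  moreover have "poly p \<mu> *s (A *v v - \<mu> *s v) \<in> W"
    by (rule vec.subspace_scale[OF invariant_subspaceD(1)[OF W(1)] eig])
  ultimately show ?case
    using vec.subspace_add[OF invariant_subspaceD(1)[OF W(1)]] by simp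
qed

definition mat_power :: "complex^'d^'d \<Rightarrow> nat \<Rightarrow> complex^'d^'d"
  where "mat_power A i = ((**) A ^^ i) (mat 1)"

lemma mat_power_mult_vec: "mat_power A i *v v = ((*v) A ^^ i) v"
  by (induction i) (simp_all add: mat_power_def flip: matrix_vector_mul_assoc)

text \<open>
  The powers of \<open>A\<close> are dependent because the matrices form a finite-dimensional space; even real
  coefficients suffice.
\<close>

lemma ex_annihilating_poly:
  fixes A :: "complex^'d^'d"
  shows "\<exists>p. p \<noteq> 0 \<and> (\<forall>v. poly_act p A v = 0)"
proof -
  define N where "N = DIM(complex^'d^'d)"
  \<comment> \<open>If two powers coincide, their difference is the relation; otherwise there are more powers than dimensions.\<close>
  have "\<exists>c :: nat \<Rightarrow> real. (\<exists>i\<le>N. c i \<noteq> 0) \<and> (\<Sum>i\<le>N. c i *\<^sub>R mat_power A i) = 0"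
  proof (cases "inj_on (mat_power A) {..N}")
    case True
    have "dependent (mat_power A ` {..N})"
      by (rule dependent_biggerset) (use True in \<open>simp add: card_image N_def\<close>)
    then obtain u where u: "\<exists>x\<in>mat_power A ` {..N}. u x \<noteq> 0"
      "(\<Sum>x\<in>mat_power A ` {..N}. u x *\<^sub>R x) = 0"
      by (auto simp: dependent_finite)
    then have "(\<Sum>i\<le>N. u (mat_power A i) *\<^sub>R mat_power A i) = 0"
      using True by (simp add: sum.reindex)
    then show ?thesis using u(1) by (intro exI[of _ "\<lambda>i. u (mat_power A i)"]) auto
  next
    case False
    then obtain i j where ij: "i \<le> N" "j \<le> N" "i \<noteq> j" "mat_power A i = mat_power A j"
      by (auto simp: inj_on_def)
    define c where "c = (\<lambda>k. (if k = i then 1 else 0) - (if k = j then 1 else 0 :: real))"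
    have "(\<Sum>k\<le>N. c k *\<^sub>R mat_power A k) = mat_power A i - mat_power A j"
      using ij by (simp add: c_def scaleR_diff_left sum_subtractf if_distrib[of "\<lambda>x. x *\<^sub>R _"] 
          cong: if_cong)
    then show ?thesis using ij by (intro exI[of _ c]) (auto simp: c_def intro!: exI[of _ i])
  qed
  then obtain c k where c: "k \<le> N" "c k \<noteq> 0" "(\<Sum>i\<le>N. c i *\<^sub>R mat_power A i) = 0"
    by auto
  define p where "p = (\<Sum>i\<le>N. monom (complex_of_real (c i)) i)"
  have coeff: "coeff p i = (if i \<le> N then of_real (c i) else 0)" for i
    by (simp add: p_def coeff_sum)
  have "degree p \<le> N" by (rule degree_le) (simp add: coeff)
  have "poly_act p A v = 0" for v
  proof -
    have sc: "complex_of_real r *s w = r *\<^sub>R w" for r and w :: "complex^'d"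
      by (simp add: vec_eq_iff complex_eq_iff)
    have "poly_act p A v = (\<Sum>i\<le>N. c i *\<^sub>R (mat_power A i *v v))"
      by (simp add: poly_act_degree_le[OF \<open>degree p \<le> N\<close>] coeff mat_power_mult_vec sc)
    also have "\<dots> = (\<Sum>i\<le>N. c i *\<^sub>R mat_power A i) *v v"
      by (simp add: matrix_vector_mult_def vec_eq_iff sum_distrib_right sum_distrib_left 
          scaleR_sum_right sum.swap[of _ "{..N}"])
    finally show ?thesis using c by simp
  qed
  moreover have "p \<noteq> 0"
  proof
    assume "p = 0" then have "coeff p k = 0" by simp
    then show False using c by (simp add: coeff)
  qed
  ultimately show ?thesis by blast
qed

text \<open>
  Take a polynomial of least degree that sends a given \<open>v \<in> V - W\<close> into \<open>W\<close> and split off a root \<open>\<mu>\<close>: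
  the cofactor still sends \<open>v\<close> outside \<open>W\<close>, to an eigenvector modulo \<open>W\<close>.
\<close>

lemma ex_eigenvector_mod:
  fixes A :: "complex^'d^'d"
  assumes V: "invariant_subspace {A} V" and W: "vec.subspace W" and nsub: "\<not> V \<subseteq> W"
  shows "\<exists>v \<mu>. v \<in> V \<and> v \<notin> W \<and> A *v v - \<mu> *s v \<in> W"
proof -
  obtain v where v: "v \<in> V" "v \<notin> W" using nsub by blast
  define P where "P = (\<lambda>p. p \<noteq> 0 \<and> poly_act p A v \<in> W)"
  obtain p0 where "P p0" using ex_annihilating_poly[of A] vec.subspace_0[OF W] unfolding P_def by metis
  then obtain p where p: "P p" and min: "\<And>q. P q \<Longrightarrow> degree p \<le> degree q"
    using ex_has_least_nat[of P p0 degree] by blast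
  have "degree p \<noteq> 0"
  proof
    assume "degree p = 0"
    then obtain c where c: "p = [:c:]" by (rule degree_eq_zeroE)
    then have "c \<noteq> 0" "c *s v \<in> W" using p by (auto simp: P_def)
    then show False using v by (simp add: subspace_scale_iff[OF W])
  qed
  then obtain \<mu> where "poly p \<mu> = 0"
    using fundamental_theorem_of_algebra[of p] by (auto simp: constant_degree)
  then obtain q where q: "p = [:- \<mu>, 1:] * q" by (auto simp: poly_eq_0_iff_dvd)
  then have "q \<noteq> 0" using p by (auto simp: P_def)
  then have "degree p = Suc (degree q)" unfolding q by (subst degree_mult_eq) auto
  then have "\<not> P q" using min[of q] by linarith
  then have "poly_act q A v \<notin> W" using \<open>q \<noteq> 0\<close> by (auto simp: P_def)
  moreover have "poly_act p A v = A *v poly_act q A v - \<mu> *s poly_act q A v"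
    unfolding q poly_act_mult by (simp add: vec_eq_iff)
  then have "A *v poly_act q A v - \<mu> *s poly_act q A v \<in> W"
    using p by (simp add: P_def)
  ultimately show ?thesis using poly_act_in_subspace[OF V] v by blast
qed

lemma finite_eigenvalues:
  fixes A :: "complex^'d^'d"
  shows "finite {\<mu>. \<exists>v. v \<noteq> 0 \<and> A *v v = \<mu> *s v}"
proof -
  obtain p where p: "p \<noteq> 0" "\<And>v. poly_act p A v = 0" using ex_annihilating_poly by blast
  have inv: "invariant_subspace {A} {0}" by (simp add: invariant_subspace_def vec.subspace_single_0)
  have "poly p \<mu> = 0" if "v \<noteq> 0" "A *v v = \<mu> *s v" for v \<mu>
    using poly_act_eigen_mod[OF inv, of A v \<mu> p] p(2)[of v] that by simp
  then have "{\<mu>. \<exists>v. v \<noteq> 0 \<and> A *v v = \<mu> *s v} \<subseteq> {\<mu>. poly p \<mu> = 0}" by blast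
  then show ?thesis using poly_roots_finite[OF p(1)] finite_subset by blast
qed

text \<open>
  The rule \<open>[p(A), B] = c p'(A)\<close>, valid wherever \<open>[A, B]\<close> acts as the scalar \<open>c\<close>.
\<close>

lemma poly_act_commutator_mod:
  fixes A B :: "complex^'d^'d"
  assumes V: "invariant_subspace {A, B} V" and W: "invariant_subspace {A, B} W"
    and comm: "\<And>v. v \<in> V \<Longrightarrow> (A ** B - B ** A) *v v - c *s v \<in> W"
    and v: "v \<in> V"
  shows "poly_act p A (B *v v) - B *v poly_act p A v - c *s poly_act (pderiv p) A v \<in> W"
proof (induction p)
  case 0
  then show ?case using W by (simp add: invariant_subspace_def vec.subspace_0)
next
  case (pCons a p)
  let ?u = "poly_act p A v"
  have "?u \<in> V" using poly_act_in_subspace[OF V _ v] by blast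
  then have 1: "(A ** B - B ** A) *v ?u - c *s ?u \<in> W" by (rule comm)
  have 2: "A *v (poly_act p A (B *v v) - B *v ?u - c *s poly_act (pderiv p) A v) \<in> W"
    using pCons W by (auto simp: invariant_subspace_def)
  have "poly_act (pCons a p) A (B *v v) - B *v poly_act (pCons a p) A v
        - c *s poly_act (pderiv (pCons a p)) A v =
      A *v (poly_act p A (B *v v) - B *v ?u - c *s poly_act (pderiv p) A v) +
      ((A ** B - B ** A) *v ?u - c *s ?u)"
    by (simp add: pderiv_pCons poly_act_add vec_eq_iff matrix_vector_mult_diff_distrib
        matrix_vector_mult_diff_rdistrib matrix_vector_right_distrib
        vector_scalar_commute algebra_simps flip: matrix_vector_mul_assoc)
  then show ?case using vec.subspace_add[OF invariant_subspaceD(1)[OF W] 2 1] by simp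
qed

text \<open>
  In characteristic zero a commutator on a nonzero finite-dimensional space cannot be a nonzero scalar.
  Instead of taking the trace on the quotient \<open>V / (V \<inter> W)\<close>, consider a polynomial \<open>p\<close> of least degree
  such that \<open>p(A)\<close> vanishes there: if \<open>c \<noteq> 0\<close> then \<open>[p(A), B] = c p'(A)\<close> shows that \<open>p'(A)\<close> vanishes as well, so \<open>p\<close> is a nonzero constant.
\<close>

lemma commutator_scalar_mod_eq_0:
  fixes A B :: "complex^'d^'d"
  assumes V: "invariant_subspace {A, B} V" and W: "invariant_subspace {A, B} W"
    and nsub: "\<not> V \<subseteq> W"
    and comm: "\<And>v. v \<in> V \<Longrightarrow> (A ** B - B ** A) *v v - c *s v \<in> W"
  shows "c = 0"
proof (rule ccontr)
  assume c: "c \<noteq> 0"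
  note sW = invariant_subspaceD(1)[OF W]
  define P where "P = (\<lambda>p. p \<noteq> 0 \<and> (\<forall>v\<in>V. poly_act p A v \<in> W))"
  obtain p0 where "P p0" using ex_annihilating_poly[of A] vec.subspace_0[OF sW] unfolding P_def by metis
  then obtain p where p: "P p" and min: "\<And>q. P q \<Longrightarrow> degree p \<le> degree q"
    using ex_has_least_nat[of P p0 degree] by blast
  have "poly_act (pderiv p) A v \<in> W" if v: "v \<in> V" for v
  proof -
    have "B *v v \<in> V" using V v by (auto simp: invariant_subspace_def)
    then have 1: "poly_act p A (B *v v) \<in> W" and 2: "B *v poly_act p A v \<in> W"
      using p v W by (auto simp: P_def invariant_subspace_def)
    have "(poly_act p A (B *v v) - B *v poly_act p A v) -
        (poly_act p A (B *v v) - B *v poly_act p A v - c *s poly_act (pderiv p) A v) \<in> W"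
      by (intro vec.subspace_diff[OF sW] 1 2 poly_act_commutator_mod[OF V W comm v])
    then show ?thesis using c by (simp add: subspace_scale_iff[OF sW])
  qed
  then have "pderiv p = 0 \<or> degree p \<le> degree (pderiv p)" using min[of "pderiv p"] by (auto simp: P_def)
  then have "degree p = 0" by (auto simp: degree_pderiv pderiv_eq_0_iff)
  then obtain a where a: "p = [:a:]" by (rule degree_eq_zeroE)
  obtain v where v: "v \<in> V" "v \<notin> W" using nsub by blast
  then show False using p a by (auto simp: P_def subspace_scale_iff[OF sW])
qed

section \<open>Simultaneous eigenvectors modulo an invariant subspace\<close>

text \<open>
  The common feature of Jordan-Hoelder bases and commuting tuples. As the bracket of two members leads
  strictly below both of them, it makes induction along the list possible.
\<close>

definition descending_brackets :: "(complex^'d^'d) list \<Rightarrow> bool"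
  where "descending_brackets T \<longleftrightarrow>
    (\<forall>i j. i < j \<and> j < length T \<longrightarrow>
      T ! i ** T ! j - T ! j ** T ! i \<in> cmat.span (set (take i T)))"

lemma mat_scale_mult_vec: "mat_scale c A *v v = c *s (A *v v)"
  by (simp add: mat_scale_def matrix_vector_mult_def vec_eq_iff sum_distrib_left mult.assoc)

lemma span_preserves:
  assumes U: "vec.subspace U" and A: "A \<in> cmat.span S"
    and S: "\<And>B. B \<in> S \<Longrightarrow> B *v v \<in> U"
  shows "A *v v \<in> U"
  using A
proof (induction rule: cmat.span_induct)
  case (step B)
  then show ?case by (rule S)
next
  case base
  show ?case unfolding cmat.subspace_def
    using U by (auto simp: mat_scale_mult_vec matrix_vector_mult_add_rdistrib
        intro: vec.subspace_add vec.subspace_scale vec.subspace_0)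
qed

lemma span_scalar_mod:
  assumes W: "vec.subspace W" and A: "A \<in> cmat.span S"
    and S: "\<And>B. B \<in> S \<Longrightarrow> \<exists>c. \<forall>v\<in>V. B *v v - c *s v \<in> W"
  shows "\<exists>c. \<forall>v\<in>V. A *v v - c *s v \<in> W"
  using A
proof (induction rule: cmat.span_induct)
  case (step B)
  then show ?case by (rule S)
next
  case base
  have 0: "\<exists>c. \<forall>v\<in>V. 0 *v v - c *s v \<in> W"
    using W by (intro exI[of _ 0]) (simp add: vec.subspace_0)
  have add: "\<exists>c. \<forall>v\<in>V. (A + B) *v v - c *s v \<in> W"
    if A: "\<forall>v\<in>V. A *v v - a *s v \<in> W" and B: "\<forall>v\<in>V. B *v v - b *s v \<in> W" for A B a b
  proof (intro exI ballI)
    fix v assume "v \<in> V"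
    then have "(A *v v - a *s v) + (B *v v - b *s v) \<in> W"
      using A B by (intro vec.subspace_add[OF W]) auto
    then show "(A + B) *v v - (a + b) *s v \<in> W"
      by (simp add: matrix_vector_mult_add_rdistrib vec.scale_left_distrib algebra_simps)
  qed
  have scale: "\<exists>c. \<forall>v\<in>V. mat_scale k A *v v - c *s v \<in> W"
    if A: "\<forall>v\<in>V. A *v v - a *s v \<in> W" for A k a
  proof (intro exI ballI)
    fix v assume "v \<in> V"
    then have "k *s (A *v v - a *s v) \<in> W"
      using A by (intro vec.subspace_scale[OF W]) auto
    then show "mat_scale k A *v v - (k * a) *s v \<in> W"
      by (simp add: mat_scale_mult_vec vec.scale_right_diff_distrib)
  qed
  show ?case unfolding cmat.subspace_def using 0 add scale by blast
qed

lemma descending_bracketsD: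
  assumes "descending_brackets T" "i < length T" "j < length T"
  shows "T ! i ** T ! j - T ! j ** T ! i \<in> cmat.span (set (take (min i j) T))"
proof (cases i j rule: linorder_cases)
  case less
  then show ?thesis using assms by (auto simp: descending_brackets_def)
next
  case equal
  then show ?thesis by (simp add: cmat.span_zero)
next
  case greater
  then have "- (T ! j ** T ! i - T ! i ** T ! j) \<in> cmat.span (set (take j T))"
    using assms by (intro cmat.span_neg) (auto simp: descending_brackets_def)
  then show ?thesis using greater by simp
qed

lemma nth_in_takeE:
  assumes "B \<in> set (take k T)" obtains i where "i < k" "i < length T" "B = T ! i"
  using assms by (auto simp: in_set_conv_nth)

lemma invariant_subspace_mono: "invariant_subspace S W \<Longrightarrow> S' \<subseteq> S \<Longrightarrow> invariant_subspace S' W"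
  by (auto simp: invariant_subspace_def)

text \<open>
  The inductive core of Lie's theorem. Suppose \<open>T\<^sub>0, \<dots>, T\<^bsub>k-1\<^esub>\<close> act as scalars on \<open>U\<close> modulo \<open>W\<close>. For
  every \<open>B\<close> in the list the bracket \<open>[T\<^sub>k, B]\<close> lies in the span of these matrices, so it acts as a scalar
  too, which must be \<open>0\<close>. Thus every \<open>B\<close> commutes with \<open>T\<^sub>k\<close> on \<open>U\<close> modulo \<open>W\<close>, and the eigenspaces of
  \<open>T\<^sub>k\<close> modulo \<open>W\<close> inside \<open>U\<close> are invariant.
\<close>

lemma ex_scalar_subspace_mod:
  assumes T: "descending_brackets T"
    and V: "invariant_subspace (set T) V" and W: "invariant_subspace (set T) W"
    and nsub: "\<not> V \<subseteq> W"
  shows "k \<le> length T \<Longrightarrow> \<exists>U. invariant_subspace (set T) U \<and> U \<subseteq> V \<and> \<not> U \<subseteq> W \<and>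
    (\<forall>i<k. \<exists>c. \<forall>v\<in>U. T ! i *v v - c *s v \<in> W)"
proof (induction k)
  case 0
  then show ?case using V nsub by blast
next
  case (Suc k)
  then obtain U where U: "invariant_subspace (set T) U" "U \<subseteq> V" "\<not> U \<subseteq> W"
    and scal: "\<And>i. i < k \<Longrightarrow> \<exists>c. \<forall>v\<in>U. T ! i *v v - c *s v \<in> W" by auto
  note sU = invariant_subspaceD(1)[OF U(1)] and sW = invariant_subspaceD(1)[OF W]
  define A where "A = T ! k"
  have AT: "A \<in> set T" using Suc by (simp add: A_def)
  have "invariant_subspace {A} U" using U(1) AT by (auto simp: invariant_subspace_def)
  then obtain v0 \<mu> where v0: "v0 \<in> U" "v0 \<notin> W" "A *v v0 - \<mu> *s v0 \<in> W"
    using ex_eigenvector_mod[OF _ sW U(3)] by blast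
  \<comment> \<open>The eigenspace modulo \<open>W\<close> is the next subspace; \<open>v0\<close> shows that it is not contained in \<open>W\<close>.\<close>
  define U' where "U' = {v \<in> U. A *v v - \<mu> *s v \<in> W}"
  have "vec.subspace U'"
  proof -
    have add: "A *v (v + w) - \<mu> *s (v + w) \<in> W"
      if "A *v v - \<mu> *s v \<in> W" "A *v w - \<mu> *s w \<in> W" for v w
      using vec.subspace_add[OF sW that]
      by (simp add: matrix_vector_right_distrib vec.scale_right_distrib algebra_simps)
    have scale: "A *v (c *s v) - \<mu> *s (c *s v) \<in> W" if "A *v v - \<mu> *s v \<in> W" for v c
      using vec.subspace_scale[OF sW that, of c]
      by (simp add: vector_scalar_commute vec.scale_right_diff_distrib vector_smult_assoc mult.commute)
    show ?thesis using sU sW add scale unfolding U'_def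
      by (intro vec.subspaceI)
        (auto simp only: mem_Collect_eq vec.subspace_0 vec.subspace_add vec.subspace_scale
          matrix_vector_mult_0_right vec.scale_zero_right diff_self)
  qed
  moreover have "B *v v \<in> U'" if B: "B \<in> set T" and v: "v \<in> U'" for B v
  proof -
    obtain j where j: "j < length T" "B = T ! j" using B by (auto simp: in_set_conv_nth)
    have "\<exists>c. \<forall>v\<in>U. (A ** B - B ** A) *v v - c *s v \<in> W"
    proof (rule span_scalar_mod[OF sW])
      show "A ** B - B ** A \<in> cmat.span (set (take (min k j) T))"
        using descending_bracketsD[OF T _ j(1), of k] Suc.prems j by (simp add: A_def)
      show "\<exists>c. \<forall>v\<in>U. C *v v - c *s v \<in> W" if "C \<in> set (take (min k j) T)" for C
        using that by (auto elim!: nth_in_takeE intro: scal)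
    qed
    then obtain c where c: "\<And>v. v \<in> U \<Longrightarrow> (A ** B - B ** A) *v v - c *s v \<in> W" by blast
    have AB: "{A, B} \<subseteq> set T" using AT B by blast
    have "c = 0"
      using commutator_scalar_mod_eq_0[OF _ _ U(3) c] U(1) W AB invariant_subspace_mono by blast
    then have "(A ** B - B ** A) *v v \<in> W" using c[of v] v by (simp add: U'_def)
    moreover have "B *v (A *v v - \<mu> *s v) \<in> W"
      using v B W by (auto simp: U'_def invariant_subspace_def)
    ultimately have "B *v (A *v v - \<mu> *s v) + (A ** B - B ** A) *v v \<in> W"
      using vec.subspace_add[OF sW] by blast
    also have "B *v (A *v v - \<mu> *s v) + (A ** B - B ** A) *v v = A *v (B *v v) - \<mu> *s (B *v v)"
      by (simp add: matrix_vector_mult_diff_distrib matrix_vector_mult_diff_rdistrib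
          vector_scalar_commute flip: matrix_vector_mul_assoc)
    finally show ?thesis using U(1) B v by (auto simp: U'_def invariant_subspace_def)
  qed
  ultimately have "invariant_subspace (set T) U'" by (simp add: invariant_subspace_def)
  moreover have "\<exists>c. \<forall>v\<in>U'. T ! i *v v - c *s v \<in> W" if "i < Suc k" for i
  proof (cases "i = k")
    case True
    then show ?thesis by (auto simp: U'_def A_def)
  next
    case False
    then show ?thesis using scal[of i] that by (auto simp: U'_def)
  qed
  ultimately show ?case using U v0 by (intro exI[of _ U']) (auto simp: U'_def)
qed

text \<open>
  For \<open>W = {0}\<close> this yields joint eigenvectors, for \<open>V = UNIV\<close> the next vector of an invariant flag.
\<close>

lemma ex_weight_vector_mod:
  assumes T: "descending_brackets T"
    and V: "invariant_subspace (set T) V" and W: "invariant_subspace (set T) W"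
    and nsub: "\<not> V \<subseteq> W"
  shows "\<exists>v \<mu>. v \<in> V \<and> v \<notin> W \<and> (\<forall>A\<in>set T. A *v v - \<mu> A *s v \<in> W)"
proof -
  obtain U where U: "U \<subseteq> V" "\<not> U \<subseteq> W"
    and scal: "\<forall>i<length T. \<exists>c. \<forall>v\<in>U. T ! i *v v - c *s v \<in> W"
    using ex_scalar_subspace_mod[OF assms order_refl] by blast
  then obtain v where v: "v \<in> U" "v \<notin> W" by blast
  have "\<forall>A\<in>set T. \<exists>c. A *v v - c *s v \<in> W"
    using scal v by (metis in_set_conv_nth)
  then obtain \<mu> where "\<forall>A\<in>set T. A *v v - \<mu> A *s v \<in> W" by metis
  then show ?thesis using v U by blast
qed

section \<open>From weights modulo a subspace to joint eigenvectors\<close>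

definition gen_eigenspace :: "complex^'d^'d \<Rightarrow> complex \<Rightarrow> (complex^'d) set"
  where "gen_eigenspace A c = {v. \<exists>a. poly_act ([:- c, 1:] ^ a) A v = 0}"

lemma poly_act_linear_power_Suc:
  "poly_act ([:- c, 1:] ^ Suc a) A v = poly_act ([:- c, 1:] ^ a) A (A *v v - c *s v)"
proof -
  have "poly_act [:- c, 1:] A v = A *v v - c *s v" by (simp add: vec_eq_iff)
  then show ?thesis
    by (metis poly_act_mult power_Suc2)
qed

lemma subspace_gen_eigenspace: "vec.subspace (gen_eigenspace A c)"
proof (rule vec.subspaceI)
  show "0 \<in> gen_eigenspace A c" by (simp add: gen_eigenspace_def)
next
  fix v w assume "v \<in> gen_eigenspace A c" "w \<in> gen_eigenspace A c"
  then obtain a b where a: "poly_act ([:- c, 1:] ^ a) A v = 0" and b: "poly_act ([:- c, 1:] ^ b) A w = 0"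
    by (auto simp: gen_eigenspace_def)
  have "poly_act ([:- c, 1:] ^ (b + a)) A v = 0" unfolding power_add poly_act_mult a by simp
  moreover have "poly_act ([:- c, 1:] ^ (a + b)) A w = 0" unfolding power_add poly_act_mult b by simp
  ultimately have "poly_act ([:- c, 1:] ^ (a + b)) A (v + w) = 0" by (simp add: poly_act_vec_add add.commute)
  then show "v + w \<in> gen_eigenspace A c" by (auto simp: gen_eigenspace_def)
qed (auto simp: gen_eigenspace_def poly_act_vec_scale)

text \<open>
  If \<open>N = A - c\<close> and \<open>N\<^bsup>a+1\<^esup> v = 0\<close>, then \<open>N (B v) = B (N v) + [A, B] v\<close>. The second summand is covered by
  the hypothesis and the first by induction on \<open>a\<close>.
\<close>

lemma gen_eigenspace_preserved:
  assumes comm: "\<And>v. v \<in> gen_eigenspace A c \<Longrightarrow> (A ** B - B ** A) *v v \<in> gen_eigenspace A c"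
    and v: "v \<in> gen_eigenspace A c"
  shows "B *v v \<in> gen_eigenspace A c"
proof -
  have "poly_act ([:- c, 1:] ^ a) A v = 0 \<Longrightarrow> B *v v \<in> gen_eigenspace A c" for a
  proof (induction a arbitrary: v)
    case 0
    then have "v = 0" by simp
    then show ?case by (simp add: vec.subspace_0[OF subspace_gen_eigenspace])
  next
    case (Suc a)
    have v: "v \<in> gen_eigenspace A c" using Suc.prems unfolding gen_eigenspace_def by blast
    have "B *v (A *v v - c *s v) \<in> gen_eigenspace A c"
      by (rule Suc.IH) (use Suc.prems poly_act_linear_power_Suc in metis)
    then have "B *v (A *v v - c *s v) + (A ** B - B ** A) *v v \<in> gen_eigenspace A c"
      by (intro vec.subspace_add[OF subspace_gen_eigenspace] comm v)
    also have "B *v (A *v v - c *s v) + (A ** B - B ** A) *v v = A *v (B *v v) - c *s (B *v v)"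
      by (simp add: matrix_vector_mult_diff_distrib matrix_vector_mult_diff_rdistrib
          vector_scalar_commute flip: matrix_vector_mul_assoc)
    finally obtain b where "poly_act ([:- c, 1:] ^ b) A (A *v (B *v v) - c *s (B *v v)) = 0"
      by (auto simp: gen_eigenspace_def)
    then have "poly_act ([:- c, 1:] ^ Suc b) A (B *v v) = 0"
      by (simp only: poly_act_linear_power_Suc)
    then show ?case unfolding gen_eigenspace_def by blast
  qed
  then show ?thesis using v by (auto simp: gen_eigenspace_def)
qed

text \<open>
  By induction along the list: \<open>[T\<^sub>k, T\<^sub>j]\<close> is a combination of members before \<open>T\<^sub>j\<close>, which preserve the
  generalised eigenspace already.
\<close>

lemma invariant_gen_eigenspace:
  assumes T: "descending_brackets T" and k: "k < length T"
  shows "invariant_subspace (set T) (gen_eigenspace (T ! k) c)"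
proof -
  let ?K = "gen_eigenspace (T ! k) c"
  have "T ! j *v v \<in> ?K" if "j < length T" "v \<in> ?K" for j v
    using that
  proof (induction j arbitrary: v rule: less_induct)
    case (less j)
    show ?case
    proof (rule gen_eigenspace_preserved[OF _ less.prems(2)])
      fix w assume w: "w \<in> ?K"
      show "(T ! k ** T ! j - T ! j ** T ! k) *v w \<in> ?K"
      proof (rule span_preserves[OF subspace_gen_eigenspace])
        show "T ! k ** T ! j - T ! j ** T ! k \<in> cmat.span (set (take (min k j) T))"
          using less.prems(1) k by (intro descending_bracketsD[OF T]) auto
        show "B *v w \<in> ?K" if "B \<in> set (take (min k j) T)" for B
          using that less.IH w by (auto elim!: nth_in_takeE)
      qed
    qed
  qed
  then show ?thesis
    by (auto simp: invariant_subspace_def subspace_gen_eigenspace in_set_conv_nth)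
qed

text \<open>
  The intersection of the generalised eigenspaces of the \<open>T\<^sub>i\<close> for \<open>\<mu>(T\<^sub>i)\<close> still sees the weight \<open>\<mu>\<close> modulo
  \<open>W\<close>. To pass to the next matrix \<open>A\<close>, factor an annihilating polynomial as \<open>(x - \<mu>(A))\<^sup>a q\<close> with
  \<open>q(\<mu>(A)) \<noteq> 0\<close>: applying \<open>q(A)\<close> to the weight vector \<open>u\<close> lands in the generalised eigenspace, and modulo
  \<open>W\<close> it only multiplies \<open>u\<close> by the nonzero number \<open>q(\<mu>(A))\<close>.
\<close>

lemma ex_gen_weight_subspace:
  assumes T: "descending_brackets T" and W: "invariant_subspace (set T) W"
    and v: "v \<notin> W" and wt: "\<And>A. A \<in> set T \<Longrightarrow> A *v v - \<mu> A *s v \<in> W"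
  shows "k \<le> length T \<Longrightarrow> \<exists>U u. invariant_subspace (set T) U \<and>
    (\<forall>i<k. U \<subseteq> gen_eigenspace (T ! i) (\<mu> (T ! i))) \<and> u \<in> U \<and> u \<notin> W \<and>
    (\<forall>A\<in>set T. A *v u - \<mu> A *s u \<in> W)"
proof (induction k)
  case 0
  show ?case using v wt by (intro exI[of _ UNIV] exI[of _ v]) (auto simp: invariant_subspace_def)
next
  case (Suc k)
  then obtain U u where U: "invariant_subspace (set T) U"
      "\<forall>i<k. U \<subseteq> gen_eigenspace (T ! i) (\<mu> (T ! i))"
    and u: "u \<in> U" "u \<notin> W" and wt_u: "\<And>A. A \<in> set T \<Longrightarrow> A *v u - \<mu> A *s u \<in> W" by auto
  note sW = invariant_subspaceD(1)[OF W]
  define A where "A = T ! k"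
  have AT: "A \<in> set T" using Suc by (simp add: A_def)
  obtain p where p: "p \<noteq> 0" "\<And>v. poly_act p A v = 0" using ex_annihilating_poly by blast
  obtain q where q: "p = [:- \<mu> A, 1:] ^ order (\<mu> A) p * q" "poly q (\<mu> A) \<noteq> 0"
    using order_decomp[OF p(1), of "\<mu> A"] by (auto simp: poly_eq_0_iff_dvd)
  define \<kappa> where "\<kappa> = poly q (\<mu> A)"
  define w where "w = poly_act q A u"
  have wU: "w \<in> U" unfolding w_def using poly_act_in_subspace[OF U(1) AT u(1)] .
  have wK: "w \<in> gen_eigenspace A (\<mu> A)"
    using p(2)[of u] by (subst (asm) q(1)) (auto simp: poly_act_mult gen_eigenspace_def w_def)
  have diff: "w - \<kappa> *s u \<in> W"
    unfolding w_def \<kappa>_def by (rule poly_act_eigen_mod[OF W AT wt_u[OF AT]])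
  have "w \<notin> W"
  proof
    assume "w \<in> W"
    then have "w - (w - \<kappa> *s u) \<in> W" using diff by (rule vec.subspace_diff[OF sW])
    then show False using u q(2) by (simp add: \<kappa>_def subspace_scale_iff[OF sW])
  qed
  moreover have "B *v w - \<mu> B *s w \<in> W" if B: "B \<in> set T" for B
  proof -
    have "B *v (w - \<kappa> *s u) - \<mu> B *s (w - \<kappa> *s u) + \<kappa> *s (B *v u - \<mu> B *s u) \<in> W"
      by (rule vec.subspace_add[OF sW
            vec.subspace_diff[OF sW invariant_subspaceD(2)[OF W B diff] vec.subspace_scale[OF sW diff]]
            vec.subspace_scale[OF sW wt_u[OF B]]])
    also have "B *v (w - \<kappa> *s u) - \<mu> B *s (w - \<kappa> *s u) + \<kappa> *s (B *v u - \<mu> B *s u) = B *v w - \<mu> B *s w"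
      by (simp add: vec_eq_iff matrix_vector_mult_diff_distrib vector_scalar_commute algebra_simps)
    finally show ?thesis .
  qed
  moreover have "invariant_subspace (set T) (U \<inter> gen_eigenspace A (\<mu> A))"
    using U(1) invariant_gen_eigenspace[OF T, of k] Suc.prems
    by (auto simp: invariant_subspace_def A_def intro: vec.subspace_inter)
  ultimately show ?case using wU wK U(2)
    by (intro exI[of _ "U \<inter> gen_eigenspace A (\<mu> A)"] exI[of _ w]) (auto simp: A_def less_Suc_eq)
qed

text \<open>
  Eigenvalues are indexed by matrices instead of positions: equal entries of a tuple have equal
  eigenvalues, so this loses nothing (see \<open>joint_point_spectrum_eq\<close>).
\<close>

definition joint_weight :: "(complex^'d^'d) set \<Rightarrow> (complex^'d^'d \<Rightarrow> complex) \<Rightarrow> bool"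
  where "joint_weight S \<mu> \<longleftrightarrow> (\<exists>x. x \<noteq> 0 \<and> (\<forall>A\<in>S. A *v x = \<mu> A *s x))"

text \<open>
  A joint eigenvector inside the intersection of generalised eigenspaces, which exists by Lie's theorem,
  can only have the prescribed eigenvalues.
\<close>

lemma weight_mod_imp_joint_weight:
  assumes T: "descending_brackets T" and W: "invariant_subspace (set T) W"
    and v: "v \<notin> W" and wt: "\<And>A. A \<in> set T \<Longrightarrow> A *v v - \<mu> A *s v \<in> W"
  shows "joint_weight (set T) \<mu>"
proof -
  obtain U u where U: "invariant_subspace (set T) U"
      "\<And>i. i < length T \<Longrightarrow> U \<subseteq> gen_eigenspace (T ! i) (\<mu> (T ! i))"
    and u: "u \<in> U" "u \<notin> W"
    using ex_gen_weight_subspace[OF assms order_refl] by blast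
  have "u \<noteq> 0" using u vec.subspace_0[OF invariant_subspaceD(1)[OF W]] by blast
  then have nz: "\<not> U \<subseteq> {0}" using u by blast
  have Z: "invariant_subspace (set T) {0}" by (simp add: invariant_subspace_def vec.subspace_single_0)
  obtain x \<nu> where x: "x \<in> U" "x \<noteq> 0" and eig: "\<And>A. A \<in> set T \<Longrightarrow> A *v x = \<nu> A *s x"
    using ex_weight_vector_mod[OF T U(1) Z nz] by auto
  have "\<nu> A = \<mu> A" if A: "A \<in> set T" for A
  proof -
    obtain a where a: "poly_act ([:- \<mu> A, 1:] ^ a) A x = 0"
      using U(2) x(1) A by (fastforce simp: gen_eigenspace_def in_set_conv_nth)
    have "poly_act ([:- \<mu> A, 1:] ^ a) A x = poly ([:- \<mu> A, 1:] ^ a) (\<nu> A) *s x"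
      using poly_act_eigen_mod[OF Z A, of x "\<nu> A" "[:- \<mu> A, 1:] ^ a"] eig[OF A] by simp
    then have "(\<nu> A - \<mu> A) ^ a = 0" using a x(2) by simp
    then show ?thesis by simp
  qed
  then show ?thesis unfolding joint_weight_def using x(2) eig by metis
qed

section \<open>Almost diagonal simultaneous form\<close>

lemma span_image_finiteE:
  fixes v :: "'i \<Rightarrow> complex^'d"
  assumes "finite K" "inj_on v K" "x \<in> vec.span (v ` K)"
  obtains c where "x = (\<Sum>i\<in>K. c i *s v i)"
proof -
  from assms obtain u where "x = (\<Sum>y\<in>v ` K. u y *s y)"
    by (auto simp: vec.span_finite)
  then show ?thesis using that[of "u \<circ> v"] by (simp add: sum.reindex[OF assms(2)])
qed

text \<open>
  The basis is built one vector at a time, \<open>K\<close> being the set of positions already filled. The span \<open>W\<close> of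
  the vectors so far is invariant, so it can be extended by an eigenvector \<open>w\<close> modulo \<open>W\<close>, whose weight is
  a joint weight. The new column consists of the coordinates of \<open>A w - \<mu>(A) w\<close>, and these become as small
  as desired when \<open>w\<close> is replaced by a small multiple.
\<close>

lemma ex_almost_diagonal_family:
  fixes K :: "'d::finite set" and T :: "(complex^'d^'d) list"
  assumes T: "descending_brackets T" and \<epsilon>: "\<epsilon> > 0"
  shows "\<exists>v l M. inj_on v K \<and> vec.independent (v ` K) \<and> (\<forall>k\<in>K. joint_weight (set T) (l k)) \<and>
    (\<forall>A\<in>set T. \<forall>k\<in>K. A *v v k = (\<Sum>i\<in>K. M A i k *s v i) \<and>
      (\<forall>i\<in>K. cmod (M A i k - (if i = k then l k A else 0)) \<le> \<epsilon>))"
  using finite[of K]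
proof (induction K rule: finite_induct)
  case empty
  show ?case by (simp add: vec.independent_empty)
next
  case (insert k K)
  then obtain v l M where inj: "inj_on v K" and ind: "vec.independent (v ` K)"
    and wt: "\<And>j. j \<in> K \<Longrightarrow> joint_weight (set T) (l j)"
    and M: "\<And>A j. A \<in> set T \<Longrightarrow> j \<in> K \<Longrightarrow> A *v v j = (\<Sum>i\<in>K. M A i j *s v i)"
      "\<And>A i j. A \<in> set T \<Longrightarrow> j \<in> K \<Longrightarrow> i \<in> K \<Longrightarrow> cmod (M A i j - (if i = j then l j A else 0)) \<le> \<epsilon>"
    by blast
  define W where "W = vec.span (v ` K)"
  have sW: "vec.subspace W" by (simp add: W_def vec.subspace_span)
  have vW: "v i \<in> W" if "i \<in> K" for i using that by (simp add: W_def vec.span_base)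
  have "A *v w \<in> W" if A: "A \<in> set T" and w: "w \<in> W" for A w
  proof -
    obtain c where "w = (\<Sum>i\<in>K. c i *s v i)"
      using w span_image_finiteE[OF \<open>finite K\<close> inj] unfolding W_def by blast
    then have "A *v w = (\<Sum>i\<in>K. c i *s (A *v v i))"
      by (simp add: vec.linear_sum[OF matrix_vector_mul_linear_gen] vector_scalar_commute)
    also have "\<dots> \<in> W"
      using A vW M(1)
      by (intro vec.subspace_sum[OF sW] vec.subspace_scale[OF sW])
         (auto intro!: vec.subspace_sum[OF sW] vec.subspace_scale[OF sW])
    finally show ?thesis .
  qed
  then have W: "invariant_subspace (set T) W" using sW by (simp add: invariant_subspace_def)
  have "card (v ` K) < CARD('d)"
    using insert.hyps psubset_card_mono[of UNIV K] by (simp add: card_image[OF inj] psubset_eq) blast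
  then have "vec.dim W < vec.dim (UNIV :: (complex^'d) set)"
    using vec.dim_span_eq_card_independent[OF ind] unfolding W_def
    by (simp only: vec.dim_UNIV vec.dimension_def card_cart_basis)
  then have "W \<noteq> UNIV" by (metis less_irrefl)
  then have "\<not> UNIV \<subseteq> W" by blast
  moreover have "invariant_subspace (set T) UNIV" by (simp add: invariant_subspace_def)
  ultimately obtain w \<mu> where w: "w \<notin> W" and wtw: "\<And>A. A \<in> set T \<Longrightarrow> A *v w - \<mu> A *s w \<in> W"
    using ex_weight_vector_mod[OF T _ W] by blast
  have "\<exists>c. A *v w - \<mu> A *s w = (\<Sum>i\<in>K. c i *s v i)" if "A \<in> set T" for A
    using wtw[OF that] span_image_finiteE[OF \<open>finite K\<close> inj] unfolding W_def by metis
  then obtain c where c: "\<And>A. A \<in> set T \<Longrightarrow> A *v w - \<mu> A *s w = (\<Sum>i\<in>K. c A i *s v i)"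
    by metis
  define s where "s = (\<Sum>A\<in>set T. \<Sum>i\<in>K. cmod (c A i))"
  have s: "cmod (c A i) \<le> s" if "A \<in> set T" "i \<in> K" for A i
  proof -
    have "cmod (c A i) \<le> (\<Sum>i\<in>K. cmod (c A i))"
      using that \<open>finite K\<close> by (intro member_le_sum) auto
    also have "\<dots> \<le> s" unfolding s_def
      using that by (intro member_le_sum[of A]) (auto intro: sum_nonneg)
    finally show ?thesis .
  qed
  have "s \<ge> 0" unfolding s_def by (intro sum_nonneg) auto
  \<comment> \<open>Scaling \<open>w\<close> by \<open>\<delta>\<close> brings every coordinate \<open>c A i\<close> of its defect below \<open>\<epsilon>\<close>.\<close>
  define \<delta> where "\<delta> = \<epsilon> / (1 + s)"
  have \<delta>: "\<delta> > 0" "\<delta> * s \<le> \<epsilon>" using \<open>s \<ge> 0\<close> \<epsilon> by (auto simp: \<delta>_def field_simps)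
  have small: "cmod (of_real \<delta> * c A i) \<le> \<epsilon>" if "A \<in> set T" "i \<in> K" for A i
  proof -
    have "\<delta> * cmod (c A i) \<le> \<delta> * s"
      using s[OF that] \<delta>(1) by (intro mult_left_mono) auto
    with \<delta>(2) have "\<delta> * cmod (c A i) \<le> \<epsilon>" by linarith
    then show ?thesis using \<delta>(1) by (simp add: norm_mult)
  qed
  define v' where "v' = v(k := of_real \<delta> *s w)"
  define l' where "l' = l(k := \<mu>)"
  define M' where "M' = (\<lambda>A i j. if j = k then (if i = k then \<mu> A else of_real \<delta> * c A i)
    else if i = k then 0 else M A i j)"
  have v'W: "v' k \<notin> W" using w \<delta> subspace_scale_iff[OF sW] by (simp add: v'_def)
  have img: "v' ` K = v ` K" using insert.hyps by (auto simp: v'_def)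
  have "inj_on v' K = inj_on v K" using insert.hyps by (intro inj_on_cong) (auto simp: v'_def)
  moreover have "v' k \<notin> v' ` (K - {k})"
  proof -
    have "v ` K \<subseteq> W" by (rule image_subsetI) (rule vW)
    then have "v' k \<notin> v' ` K" unfolding img using v'W by (rule contra_subsetD)
    then show ?thesis using insert.hyps by simp
  qed
  ultimately have 1: "inj_on v' (insert k K)" using inj by (simp only: inj_on_insert simp_thms)
  have 2: "vec.independent (v' ` insert k K)"
    using vec.independent_insertI[OF _ ind, of "v' k"] v'W by (simp add: img W_def)
  have 3: "joint_weight (set T) (l' j)" if "j \<in> insert k K" for j
    using that wt insert.hyps weight_mod_imp_joint_weight[OF T W w wtw] by (auto simp: l'_def)
  have 4: "A *v v' j = (\<Sum>i\<in>insert k K. M' A i j *s v' i)" if A: "A \<in> set T" and j: "j \<in> insert k K" for A j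
  proof -
    have eqK: "(\<Sum>i\<in>K. f i *s v' i) = (\<Sum>i\<in>K. f i *s v i)" for f
      using insert.hyps by (intro sum.cong) (auto simp: v'_def)
    have MK: "(\<Sum>i\<in>K. M' A i j *s v' i) = (\<Sum>i\<in>K. (if j = k then of_real \<delta> * c A i else M A i j) *s v i)"
      unfolding eqK using insert.hyps by (intro sum.cong) (auto simp: M'_def)
    show ?thesis
    proof (cases "j = k")
      case True
      have "A *v v' k = of_real \<delta> *s (\<mu> A *s w + (A *v w - \<mu> A *s w))"
        by (simp add: v'_def vector_scalar_commute)
      also have "\<dots> = \<mu> A *s v' k + (\<Sum>i\<in>K. (of_real \<delta> * c A i) *s v i)"
        unfolding c[OF A] 
        by (simp add: v'_def vec.scale_right_distrib vector_smult_assoc vec.scale_sum_right mult.commute)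
      finally show ?thesis using insert.hyps MK True by (simp add: M'_def)
    next
      case False
      then show ?thesis using insert.hyps MK j M(1)[OF A, of j] by (simp add: M'_def) (simp add: v'_def)
    qed
  qed
  have 5: "cmod (M' A i j - (if i = j then l' j A else 0)) \<le> \<epsilon>"
    if "A \<in> set T" "j \<in> insert k K" "i \<in> insert k K" for A i j
    using that small \<epsilon> M(2)[of A j i] insert.hyps by (auto simp: M'_def l'_def)
  show ?case
    by (rule exI[of _ v'], rule exI[of _ l'], rule exI[of _ M']) (use 1 2 3 4 5 in blast)
qed

lemma ex_almost_diagonalisation:
  fixes T :: "(complex^'d^'d) list"
  assumes T: "descending_brackets T" and \<epsilon>: "\<epsilon> > 0"
  obtains P Q :: "complex^'d^'d" and l where "P ** Q = mat 1"
    "\<And>k. joint_weight (set T) (l k)"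
    "\<And>A i k. A \<in> set T \<Longrightarrow> cmod ((Q ** A ** P) $ i $ k - (if i = k then l k A else 0)) \<le> \<epsilon>"
proof -
  obtain v :: "'d \<Rightarrow> complex^'d" and l M where inj: "inj v" and ind: "vec.independent (range v)"
    and wt: "\<And>k. joint_weight (set T) (l k)"
    and M: "\<And>A k. A \<in> set T \<Longrightarrow> A *v v k = (\<Sum>i\<in>UNIV. M A i k *s v i)"
      "\<And>A i k. A \<in> set T \<Longrightarrow> cmod (M A i k - (if i = k then l k A else 0)) \<le> \<epsilon>"
    using ex_almost_diagonal_family[OF T \<epsilon>, of UNIV] unfolding ball_UNIV by blast
  \<comment> \<open>The matrix with columns \<open>v k\<close>, which is the change from adapted to standard coordinates.\<close>
  define P :: "complex^'d^'d" where "P = (\<chi> i k. v k $ i)"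
  have cols: "columns P = range v"
    by (auto simp: columns_def column_def P_def vec_lambda_eta vec_nth_inverse image_def)
  have "vec.dim (UNIV :: (complex^'d) set) \<le> card (range v)"
    by (simp only: vec.dim_UNIV vec.dimension_def card_cart_basis card_image[OF inj])
  then have "vec.span (columns P) = UNIV"
    using vec.card_ge_dim_independent[OF _ ind, of UNIV] by (auto simp: cols)
  then obtain Q where PQ: "P ** Q = mat 1" using matrix_right_invertible_span_columns by blast
  have QP: "Q ** P = mat 1" using PQ matrix_left_right_inverse by blast
  have "Q ** A ** P = (\<chi> i k. M A i k)" if A: "A \<in> set T" for A
  proof -
    have "(A ** P) $ i $ k = (P ** (\<chi> i k. M A i k)) $ i $ k" for i k
    proof -
      have "(A ** P) $ i $ k = (A *v v k) $ i"
        by (simp add: matrix_matrix_mult_def matrix_vector_mult_def P_def)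
      then show ?thesis 
        by (simp add: M(1)[OF A] matrix_matrix_mult_def P_def sum_component mult.commute)
    qed
    then have "A ** P = P ** (\<chi> i k. M A i k)" by (simp add: vec_eq_iff)
    then have "Q ** (A ** P) = (Q ** P) ** (\<chi> i k. M A i k)" by (simp add: matrix_mul_assoc)
    then show ?thesis by (simp add: QP matrix_mul_assoc)
  qed
  then have "cmod ((Q ** A ** P) $ i $ k - (if i = k then l k A else 0)) \<le> \<epsilon>" if "A \<in> set T" for A i k
    using M(2)[OF that, of i k] that by simp
  then show ?thesis using that[of P Q l] PQ wt by blast
qed

section \<open>The p-norm of a finite family\<close>

lemma pnorm_infinity: "pnorm top I f = Max ((\<lambda>i. norm (f i)) ` I)"
  by (simp add: pnorm_def)

lemma pnorm_finite: "p \<noteq> top \<Longrightarrow> pnorm p I f = (\<Sum>i\<in>I. norm (f i) powr enn2real p) powr (1 / enn2real p)"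
  by (simp add: pnorm_def)

lemma enn2real_ge_1: "1 \<le> p \<Longrightarrow> p \<noteq> top \<Longrightarrow> 1 \<le> enn2real p"
  by (cases p rule: ennreal_cases) (auto simp: ennreal_ge_1)

lemma pnorm_powr:
  assumes "1 \<le> p" "p \<noteq> top"
  shows "pnorm p I f powr enn2real p = (\<Sum>i\<in>I. norm (f i) powr enn2real p)"
  using enn2real_ge_1[OF assms] by (simp add: pnorm_finite assms powr_powr sum_nonneg)

lemma pnorm_nonneg:
  assumes "finite I" "I \<noteq> {}"
  shows "0 \<le> pnorm p I f"
proof (cases "p = top")
  case True
  obtain i where "i \<in> I" using assms by blast
  then have "0 \<le> norm (f i)" "norm (f i) \<le> Max ((\<lambda>i. norm (f i)) ` I)" using assms by auto
  then show ?thesis unfolding True pnorm_infinity by linarith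
qed (simp add: pnorm_finite)

lemma pnorm_leI:
  assumes p: "1 \<le> p" "p \<noteq> top" and "0 \<le> b" "(\<Sum>i\<in>I. norm (f i) powr enn2real p) \<le> b powr enn2real p"
  shows "pnorm p I f \<le> b"
proof -
  let ?q = "enn2real p"
  have q: "1 \<le> ?q" using enn2real_ge_1[OF p] .
  have "pnorm p I f \<le> (b powr ?q) powr (1 / ?q)"
    unfolding pnorm_finite[OF p(2)] using assms q by (intro powr_mono2) (auto intro: sum_nonneg)
  also have "\<dots> = b" using q assms by (simp add: powr_powr)
  finally show ?thesis .
qed

lemma norm_le_pnorm:
  assumes p: "1 \<le> p" and I: "finite I" "i \<in> I"
  shows "norm (f i) \<le> pnorm p I f"
proof (cases "p = top")
  case True
  then show ?thesis using I by (simp add: pnorm_infinity)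
next
  case False
  let ?q = "enn2real p"
  have q: "1 \<le> ?q" using enn2real_ge_1[OF p False] .
  have "norm (f i) powr ?q \<le> (\<Sum>i\<in>I. norm (f i) powr ?q)" using I by (intro member_le_sum) auto
  then have "(norm (f i) powr ?q) powr (1 / ?q) \<le> pnorm p I f"
    unfolding pnorm_finite[OF False] using q by (intro powr_mono2) auto
  then show ?thesis using q by (simp add: powr_powr)
qed

lemma pnorm_mono:
  assumes p: "1 \<le> p" and I: "finite I" "I \<noteq> {}" and le: "\<And>i. i \<in> I \<Longrightarrow> norm (f i) \<le> norm (g i)"
  shows "pnorm p I f \<le> pnorm p I g"
proof (cases "p = top")
  case True
  have "norm (f i) \<le> pnorm p I g" if "i \<in> I" for i
    using le[OF that] norm_le_pnorm[OF p I(1) that, of g] by linarith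
  then show ?thesis using I True by (simp add: pnorm_infinity)
next
  case False
  then show ?thesis using enn2real_ge_1[OF p False] le
    by (intro pnorm_leI[OF p False] pnorm_nonneg I) (auto simp: pnorm_powr[OF p False] intro!: sum_mono powr_mono2)
qed

lemma pnorm_cong:
  assumes "\<And>i. i \<in> I \<Longrightarrow> norm (f i) = norm (g i)"
  shows "pnorm p I f = pnorm p I g"
  unfolding pnorm_def using assms by (simp cong: image_cong)

lemma pnorm_scale:
  fixes f :: "'i \<Rightarrow> real"
  assumes p: "1 \<le> p" and I: "finite I" "I \<noteq> {}" and c: "0 \<le> c"
  shows "pnorm p I (\<lambda>i. c * f i) = c * pnorm p I f"
proof (cases "p = top")
  case True
  have "mono ((*) c)" using c by (simp add: mono_def mult_left_mono)
  then have "c * Max ((\<lambda>i. norm (f i)) ` I) = Max ((*) c ` (\<lambda>i. norm (f i)) ` I)"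
    using I by (intro mono_Max_commute) auto
  then show ?thesis using c True by (simp add: pnorm_infinity image_image abs_mult)
next
  case False
  have "1 \<le> enn2real p" using enn2real_ge_1[OF p False] .
  then show ?thesis using c
    by (simp add: pnorm_finite[OF False] abs_mult powr_mult powr_powr sum_nonneg flip: sum_distrib_left)
qed

lemma powr_convex_nonneg:
  assumes q: "1 \<le> (q::real)" and t: "0 \<le> t" "t \<le> 1" and xy: "0 \<le> x" "0 \<le> y"
  shows "(t * x + (1 - t) * y) powr q \<le> t * x powr q + (1 - t) * y powr q"
proof -
  \<comment> \<open>Convexity is first known on positive reals; if one argument is \<open>0\<close>, it reduces to \<open>s powr q \<le> s\<close>.\<close>
  have *: "(s * z) powr q \<le> s * z powr q" if "0 \<le> s" "s \<le> 1" "0 \<le> z" for s z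
  proof -
    have "s powr q \<le> s powr 1" using that q by (intro powr_mono') auto
    then have "s powr q * z powr q \<le> s * z powr q" using that by (intro mult_right_mono) auto
    then show ?thesis using that by (simp add: powr_mult)
  qed
  consider "x = 0" | "y = 0" | "x > 0" "y > 0" using xy by linarith
  then show ?thesis
  proof cases
    case 3
    then show ?thesis using convex_onD[OF powr_convex[OF q], of "1 - t" x y] t by simp
  qed (use * t xy q in auto)
qed

text \<open>
  Minkowski's inequality. After division by \<open>\<parallel>f\<parallel> + \<parallel>g\<parallel>\<close> the sum is a convex combination of
  \<open>f / \<parallel>f\<parallel>\<close> and \<open>g / \<parallel>g\<parallel>\<close>, so convexity of \<open>x powr q\<close> bounds it termwise.
\<close>

lemma pnorm_triangle:
  fixes f g :: "'i \<Rightarrow> real"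
  assumes p: "1 \<le> p" and I: "finite I" "I \<noteq> {}" and fg: "\<And>i. i \<in> I \<Longrightarrow> 0 \<le> f i" "\<And>i. i \<in> I \<Longrightarrow> 0 \<le> g i"
  shows "pnorm p I (\<lambda>i. f i + g i) \<le> pnorm p I f + pnorm p I g"
proof -
  let ?a = "pnorm p I f" and ?b = "pnorm p I g"
  have f_le: "f i \<le> ?a" and g_le: "g i \<le> ?b" if "i \<in> I" for i
    using norm_le_pnorm[OF p I(1) that, of f] norm_le_pnorm[OF p I(1) that, of g] fg that by auto
  have nn: "0 \<le> ?a" "0 \<le> ?b" using pnorm_nonneg[OF I] by auto
  show ?thesis
  proof (cases "p = top")
    case True
    have "f i + g i \<le> ?a + ?b" if "i \<in> I" for i using f_le g_le that by (intro add_mono)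
    then have "Max ((\<lambda>i. norm (f i + g i)) ` I) \<le> ?a + ?b" using I fg by auto
    then show ?thesis using True by (simp add: pnorm_infinity)
  next
    case False
    let ?q = "enn2real p"
    have q: "1 \<le> ?q" using enn2real_ge_1[OF p False] .
    consider "?a = 0" | "?b = 0" | "?a > 0" "?b > 0" using nn by linarith
    then show ?thesis
    proof cases
      case 1
      then have "f i = 0" if "i \<in> I" for i using f_le fg that by (metis antisym)
      then have "pnorm p I (\<lambda>i. f i + g i) = ?b" by (intro pnorm_cong) auto
      then show ?thesis using nn by simp
    next
      case 2
      then have "g i = 0" if "i \<in> I" for i using g_le fg that by (metis antisym)
      then have "pnorm p I (\<lambda>i. f i + g i) = ?a" by (intro pnorm_cong) auto
      then show ?thesis using nn by simp
    next
      case 3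
      define s where "s = ?a + ?b"
      define t where "t = ?a / s"
      have s: "s > 0" using 3 by (simp add: s_def)
      have t: "0 \<le> t" "t \<le> 1" "1 - t = ?b / s" using 3 by (auto simp: t_def s_def field_simps)
      have "(f i + g i) powr ?q \<le>
          s powr ?q * (t * (f i powr ?q / ?a powr ?q) + (1 - t) * (g i powr ?q / ?b powr ?q))"
        if i: "i \<in> I" for i
      proof -
        have "s * (t * (f i / ?a) + (1 - t) * (g i / ?b)) = f i + g i"
          using 3 s unfolding t(3) by (simp add: t_def distrib_left)
        then have "(f i + g i) powr ?q = (s * (t * (f i / ?a) + (1 - t) * (g i / ?b))) powr ?q"
          by simp
        also have "\<dots> = s powr ?q * (t * (f i / ?a) + (1 - t) * (g i / ?b)) powr ?q"
          using s t fg[OF i] 3 by (intro powr_mult) 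
        also have "\<dots> \<le> s powr ?q * (t * (f i / ?a) powr ?q + (1 - t) * (g i / ?b) powr ?q)"
          using s t fg[OF i] 3 q by (intro mult_left_mono powr_convex_nonneg) auto
        finally show ?thesis using fg[OF i] 3 by (simp add: powr_divide)
      qed
      then have "(\<Sum>i\<in>I. (f i + g i) powr ?q) \<le>
          (\<Sum>i\<in>I. s powr ?q * (t * (f i powr ?q / ?a powr ?q) + (1 - t) * (g i powr ?q / ?b powr ?q)))"
        by (rule sum_mono)
      also have "\<dots> = s powr ?q * (t * ((\<Sum>i\<in>I. f i powr ?q) / ?a powr ?q)
          + (1 - t) * ((\<Sum>i\<in>I. g i powr ?q) / ?b powr ?q))"
        by (simp only: sum_distrib_left sum_divide_distrib sum.distrib[symmetric])
      also have "\<dots> = s powr ?q"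
      proof -
        have "(\<Sum>i\<in>I. f i powr ?q) = ?a powr ?q" "(\<Sum>i\<in>I. g i powr ?q) = ?b powr ?q"
          using fg by (auto simp: pnorm_powr[OF p False] intro!: sum.cong)
        then show ?thesis using 3 by simp
      qed
      finally have "(\<Sum>i\<in>I. (f i + g i) powr ?q) \<le> s powr ?q" .
      then have "(\<Sum>i\<in>I. norm (f i + g i) powr ?q) \<le> s powr ?q" using fg by simp
      then show ?thesis unfolding s_def[symmetric] using s by (intro pnorm_leI[OF p False]) auto
    qed
  qed
qed

text \<open>
  The reason for measuring the family of images in the same \<open>p\<close>-norm as the vectors: iterated norms
  become norms over a product, in particular their order can be exchanged.
\<close>

lemma pnorm_nested:
  assumes p: "1 \<le> p" and I: "finite I" "I \<noteq> {}" and J: "finite J" "J \<noteq> {}"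
  shows "pnorm p I (\<lambda>i. pnorm p J (f i)) = pnorm p (I \<times> J) (\<lambda>(i, j). f i j)"
proof (cases "p = top")
  case True
  have nn: "norm (pnorm p J (f i)) = pnorm p J (f i)" for i using pnorm_nonneg[OF J, of p "f i"] by simp
  show ?thesis
  proof (rule antisym)
    have "pnorm p J (f i) \<le> pnorm p (I \<times> J) (\<lambda>(i, j). f i j)" if "i \<in> I" for i
      using norm_le_pnorm[OF p, of "I \<times> J" "(i, _)" "\<lambda>(i, j). f i j"] that I J
      by (auto simp: True pnorm_infinity[of J])
    then show "pnorm p I (\<lambda>i. pnorm p J (f i)) \<le> pnorm p (I \<times> J) (\<lambda>(i, j). f i j)"
      using I nn by (auto simp: True pnorm_infinity[of I])
  next
    have "norm (f i j) \<le> pnorm p I (\<lambda>i. pnorm p J (f i))" if "i \<in> I" "j \<in> J" for i j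
      using norm_le_pnorm[OF p J(1) that(2), of "f i"] norm_le_pnorm[OF p I(1) that(1), of "\<lambda>i. pnorm p J (f i)"] nn[of i] by linarith
    then show "pnorm p (I \<times> J) (\<lambda>(i, j). f i j) \<le> pnorm p I (\<lambda>i. pnorm p J (f i))"
      using I J by (auto simp: True pnorm_infinity[of "I \<times> J"])
  qed
next
  case False
  have "norm (pnorm p J (f i)) powr enn2real p = (\<Sum>j\<in>J. norm (f i j) powr enn2real p)" for i
    using pnorm_powr[OF p False, of J "f i"] pnorm_nonneg[OF J, of p "f i"] by simp
  then show ?thesis
    by (simp add: pnorm_finite[OF False, of I] pnorm_finite[OF False, of "I \<times> J"] sum.cartesian_product case_prod_beta)
qed

lemma pnorm_swap:
  assumes p: "1 \<le> p" and I: "finite I" "I \<noteq> {}" and J: "finite J" "J \<noteq> {}"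
  shows "pnorm p I (\<lambda>i. pnorm p J (f i)) = pnorm p J (\<lambda>j. pnorm p I (\<lambda>i. f i j))"
proof (cases "p = top")
  case True
  have "(\<lambda>(i, j). norm (f i j)) ` (I \<times> J) = (\<lambda>(j, i). norm (f i j)) ` (J \<times> I)" by force
  then show ?thesis
    unfolding pnorm_nested[OF p I J] pnorm_nested[OF p J I] unfolding True pnorm_infinity
    by (simp add: case_prod_beta)
next
  case False
  have "(\<Sum>i\<in>I. \<Sum>j\<in>J. norm (f i j) powr enn2real p) = (\<Sum>j\<in>J. \<Sum>i\<in>I. norm (f i j) powr enn2real p)"
    by (rule sum.swap)
  then show ?thesis
    unfolding pnorm_nested[OF p I J] pnorm_nested[OF p J I] unfolding pnorm_finite[OF False]
    by (simp add: sum.cartesian_product case_prod_beta)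
qed

text \<open>
  Powers of a tuple are lists built by concatenation, for which a norm over list entries is handier than
  one over positions.
\<close>

definition list_pnorm :: "ennreal \<Rightarrow> ('b \<Rightarrow> real) \<Rightarrow> 'b list \<Rightarrow> real"
  where "list_pnorm p f xs = pnorm p {..<length xs} (\<lambda>i. f (xs ! i))"

lemma list_pnorm_infinity: "list_pnorm top f xs = pnorm top (set xs) f"
proof -
  have "(\<lambda>i. \<bar>f (xs ! i)\<bar>) ` {..<length xs} = (\<lambda>x. \<bar>f x\<bar>) ` set xs"
    by (force simp: in_set_conv_nth)
  then show ?thesis by (simp add: list_pnorm_def pnorm_infinity)
qed

lemma list_pnorm_finite:
  "p \<noteq> top \<Longrightarrow> list_pnorm p f xs = sum_list (map (\<lambda>x. \<bar>f x\<bar> powr enn2real p) xs) powr (1 / enn2real p)"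
  by (simp add: list_pnorm_def pnorm_finite sum_list_sum_nth atLeast0LessThan)

lemma list_pnorm_nonneg: "xs \<noteq> [] \<Longrightarrow> 0 \<le> list_pnorm p f xs"
  by (simp add: list_pnorm_def pnorm_nonneg lessThan_empty_iff)

lemma list_pnorm_mono:
  assumes "1 \<le> p" "xs \<noteq> []" "\<And>x. x \<in> set xs \<Longrightarrow> 0 \<le> f x" "\<And>x. x \<in> set xs \<Longrightarrow> f x \<le> g x"
  shows "list_pnorm p f xs \<le> list_pnorm p g xs"
  unfolding list_pnorm_def using assms
  by (intro pnorm_mono) (auto simp: lessThan_empty_iff, smt (verit) nth_mem)

lemma list_pnorm_cong:
  assumes "\<And>x. x \<in> set xs \<Longrightarrow> f x = g x"
  shows "list_pnorm p f xs = list_pnorm p g xs"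
  unfolding list_pnorm_def using assms by (intro pnorm_cong) auto

lemma list_pnorm_scale:
  assumes "1 \<le> p" "xs \<noteq> []" "0 \<le> c"
  shows "list_pnorm p (\<lambda>x. c * f x) xs = c * list_pnorm p f xs"
  unfolding list_pnorm_def using assms by (intro pnorm_scale) (auto simp: lessThan_empty_iff)

lemma sum_list_concat: "sum_list (concat xss) = sum_list (map sum_list xss)"
  by (induction xss) simp_all

text \<open>
  The iterated norm is stated with the inner norm over \<open>xs\<close>, the leftmost factor
  of a product, because the one-step estimates apply to the matrix applied last.
\<close>

lemma list_pnorm_concat_map:
  assumes p: "1 \<le> p" and ne: "xs \<noteq> []" "ys \<noteq> []"
  shows "list_pnorm p f (concat (map (\<lambda>x. map (h x) ys) xs)) =
    list_pnorm p (\<lambda>y. list_pnorm p (\<lambda>x. f (h x y)) xs) ys"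
proof -
  have "list_pnorm p f (concat (map (\<lambda>x. map (h x) ys) xs)) =
      list_pnorm p (\<lambda>x. list_pnorm p (\<lambda>y. f (h x y)) ys) xs"
  proof (cases "p = top")
    case True
    have "set (concat (map (\<lambda>x. map (h x) ys) xs)) = (\<lambda>(x, y). h x y) ` (set xs \<times> set ys)"
      by auto
    then have "list_pnorm p f (concat (map (\<lambda>x. map (h x) ys) xs)) =
        pnorm p (set xs \<times> set ys) (\<lambda>(x, y). f (h x y))"
      unfolding True list_pnorm_infinity pnorm_infinity by (simp add: image_image case_prod_beta)
    also have "\<dots> = pnorm p (set xs) (\<lambda>x. pnorm p (set ys) (\<lambda>y. f (h x y)))"
      by (rule pnorm_nested[symmetric]) (use p ne in auto)
    finally show ?thesis unfolding True list_pnorm_infinity .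
  next
    case False
    have "\<bar>list_pnorm p g ys\<bar> powr enn2real p = sum_list (map (\<lambda>y. \<bar>g y\<bar> powr enn2real p) ys)" for g
    proof -
      have "0 \<le> sum_list (map (\<lambda>y. \<bar>g y\<bar> powr enn2real p) ys)" by (intro sum_list_nonneg) auto
      then show ?thesis
        using enn2real_ge_1[OF p False] by (simp add: list_pnorm_finite[OF False] powr_powr)
    qed
    then show ?thesis
      by (simp add: list_pnorm_finite[OF False] map_concat comp_def sum_list_concat)
  qed
  also have "\<dots> = list_pnorm p (\<lambda>y. list_pnorm p (\<lambda>x. f (h x y)) xs) ys"
    unfolding list_pnorm_def using ne by (intro pnorm_swap[OF p]) (auto simp: lessThan_empty_iff)
  finally show ?thesis .
qed

lemma list_pnorm_singleton:
  assumes "1 \<le> p"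
  shows "list_pnorm p f [x] = \<bar>f x\<bar>"
proof (cases "p = top")
  case True
  then show ?thesis by (simp add: list_pnorm_infinity pnorm_infinity)
next
  case False
  then show ?thesis using enn2real_ge_1[OF assms False] by (simp add: list_pnorm_finite powr_powr)
qed

section \<open>Vector norms and the norm of a tuple of matrices\<close>

lemma vec_pnorm_nonneg: "0 \<le> vec_pnorm p x"
  by (simp add: vec_pnorm_def pnorm_nonneg)

lemma vec_pnorm_norm: "vec_pnorm p x = pnorm p UNIV (\<lambda>i. cmod (x $ i))"
  unfolding vec_pnorm_def by (rule pnorm_cong) simp

lemma component_le_vec_pnorm: "1 \<le> p \<Longrightarrow> cmod (x $ i) \<le> vec_pnorm p x"
  unfolding vec_pnorm_def by (rule norm_le_pnorm) auto

lemma vec_pnorm_scale: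
  assumes "1 \<le> p"
  shows "vec_pnorm p (c *s x) = cmod c * vec_pnorm p x"
  unfolding vec_pnorm_norm using pnorm_scale[OF assms, of UNIV "cmod c" "\<lambda>i. cmod (x $ i)"]
  by (simp add: norm_mult)

lemma vec_pnorm_pos:
  assumes "1 \<le> p" "x \<noteq> 0"
  shows "0 < vec_pnorm p x"
proof -
  obtain i where "x $ i \<noteq> 0" using assms(2) by (auto simp: vec_eq_iff)
  then show ?thesis using component_le_vec_pnorm[OF assms(1), of x i]
    by (smt (verit) zero_less_norm_iff)
qed

lemma ex_vec_pnorm_bound:
  fixes A :: "complex^'d^'d"
  assumes p: "1 \<le> p"
  shows "\<exists>C>0. \<forall>x. vec_pnorm p (A *v x) \<le> C * vec_pnorm p x"
proof -
  define s where "s = (\<lambda>i. \<Sum>k\<in>UNIV. cmod (A $ i $ k))"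
  have s: "0 \<le> s i" for i by (simp add: s_def sum_nonneg)
  have "vec_pnorm p (A *v x) \<le> pnorm p UNIV s * vec_pnorm p x" for x
  proof -
    have "cmod ((A *v x) $ i) \<le> vec_pnorm p x * s i" for i
    proof -
      have "cmod ((A *v x) $ i) \<le> (\<Sum>k\<in>UNIV. cmod (A $ i $ k) * cmod (x $ k))"
        unfolding matrix_vector_mult_def by (simp flip: norm_mult add: norm_sum)
      also have "\<dots> \<le> (\<Sum>k\<in>UNIV. cmod (A $ i $ k) * vec_pnorm p x)"
        by (intro sum_mono mult_left_mono component_le_vec_pnorm p) auto
      finally show ?thesis unfolding s_def by (simp add: sum_distrib_left mult.commute)
    qed
    then have "vec_pnorm p (A *v x) \<le> pnorm p UNIV (\<lambda>i. vec_pnorm p x * s i)"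
      unfolding vec_pnorm_norm[of p "A *v x"]
      by (intro pnorm_mono p) (auto simp: s vec_pnorm_nonneg abs_mult)
    also have "\<dots> = vec_pnorm p x * pnorm p UNIV s"
      by (intro pnorm_scale p) (auto simp: vec_pnorm_nonneg)
    finally show ?thesis by (simp add: mult.commute)
  qed
  moreover have "pnorm p UNIV s * vec_pnorm p x \<le> (pnorm p UNIV s + 1) * vec_pnorm p x" for x :: "complex^'d"
    by (intro mult_right_mono) (auto simp: vec_pnorm_nonneg)
  moreover have "0 < pnorm p UNIV s + 1" using pnorm_nonneg[of UNIV p s] by simp
  ultimately show ?thesis by (meson order_trans)
qed

lemma vec_pnorm_0: "1 \<le> p \<Longrightarrow> vec_pnorm p 0 = 0"
  using vec_pnorm_scale[of p 0 0] by simp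

lemma op_pnorm_list: "op_pnorm p S = (SUP x\<in>{x. vec_pnorm p x \<le> 1}. list_pnorm p (\<lambda>A. vec_pnorm p (A *v x)) S)"
  by (simp add: op_pnorm_def list_pnorm_def)

text \<open>
  The supremum defining the tuple norm is only meaningful once the set is known to be bounded; the
  operator bounds of the individual matrices provide this.
\<close>

lemma list_pnorm_le_op_pnorm:
  fixes S :: "(complex^'d^'d) list"
  assumes p: "1 \<le> p" and S: "S \<noteq> []" and x: "vec_pnorm p x \<le> 1"
  shows "list_pnorm p (\<lambda>A. vec_pnorm p (A *v x)) S \<le> op_pnorm p S"
  unfolding op_pnorm_list
proof (rule cSUP_upper)
  have "\<forall>A :: complex^'d^'d. \<exists>C>0. \<forall>x. vec_pnorm p (A *v x) \<le> C * vec_pnorm p x"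
    using ex_vec_pnorm_bound[OF p] by blast
  then obtain C where C: "\<And>A :: complex^'d^'d. 0 < C A"
      "\<And>A x. vec_pnorm p (A *v x) \<le> C A * vec_pnorm p x"
    by metis
  have "list_pnorm p (\<lambda>A. vec_pnorm p (A *v x)) S \<le> list_pnorm p C S" if "vec_pnorm p x \<le> 1" for x
  proof (rule list_pnorm_mono[OF p S vec_pnorm_nonneg])
    fix A
    have "vec_pnorm p (A *v x) \<le> C A * vec_pnorm p x" by (rule C(2))
    also have "\<dots> \<le> C A * 1" using C(1)[of A] that by (intro mult_left_mono) auto
    finally show "vec_pnorm p (A *v x) \<le> C A" by simp
  qed
  then show "bdd_above ((\<lambda>x. list_pnorm p (\<lambda>A. vec_pnorm p (A *v x)) S) ` {x. vec_pnorm p x \<le> 1})"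
    by (intro bdd_aboveI2[of _ _ "list_pnorm p C S"]) auto
qed (use x in simp)

lemma op_pnorm_nonneg:
  fixes S :: "(complex^'d^'d) list"
  assumes p: "1 \<le> p" and S: "S \<noteq> []"
  shows "0 \<le> op_pnorm p S"
  using list_pnorm_le_op_pnorm[OF p S, of 0] list_pnorm_nonneg[OF S, of p "\<lambda>A. vec_pnorm p (A *v 0)"]
  by (simp add: vec_pnorm_0[OF p])

lemma op_pnorm_leI:
  assumes "1 \<le> p" "\<And>x. vec_pnorm p x \<le> 1 \<Longrightarrow> list_pnorm p (\<lambda>A. vec_pnorm p (A *v x)) S \<le> b"
  shows "op_pnorm p S \<le> b"
  unfolding op_pnorm_list
proof (rule cSUP_least)
  show "{x. vec_pnorm p x \<le> 1} \<noteq> {}" by (auto intro!: exI[of _ 0] simp: vec_pnorm_0[OF assms(1)])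
qed (use assms in auto)

section \<open>Powers of a tuple\<close>

lemma tuple_power_0: "tuple_power T 0 = [mat 1]"
  by (simp add: tuple_power_def)

lemma tuple_power_Suc:
  "tuple_power T (Suc m) = concat (map (\<lambda>A. map ((**) A) (tuple_power T m)) T)"
  by (simp add: tuple_power_def map_concat comp_def)

lemma tuple_power_nonempty: "T \<noteq> [] \<Longrightarrow> tuple_power T m \<noteq> []"
  by (induction m) (auto simp: tuple_power_0 tuple_power_Suc neq_Nil_conv)

lemma list_pnorm_tuple_power_Suc:
  assumes "1 \<le> p" "T \<noteq> []"
  shows "list_pnorm p (\<lambda>B. N (B *v x)) (tuple_power T (Suc m)) =
    list_pnorm p (\<lambda>B. list_pnorm p (\<lambda>A. N (A *v (B *v x))) T) (tuple_power T m)"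
  unfolding tuple_power_Suc
  using list_pnorm_concat_map[OF assms tuple_power_nonempty[OF assms(2)], of "\<lambda>B. N (B *v x)" "(**)" m]
  by (simp add: matrix_vector_mul_assoc)

text \<open>
  A one-step bound by \<open>R\<close> on the \<open>p\<close>-norm of all images iterates, since each further factor is measured by
  its own inner norm.
\<close>

lemma tuple_power_growth_le:
  assumes p: "1 \<le> p" and T: "T \<noteq> []" and N: "\<And>z. 0 \<le> N z" and R: "0 \<le> R"
    and step: "\<And>z. list_pnorm p (\<lambda>A. N (A *v z)) T \<le> R * N z"
  shows "list_pnorm p (\<lambda>B. N (B *v x)) (tuple_power T m) \<le> R ^ m * N x"
proof (induction m)
  case 0
  then show ?case using N by (simp add: tuple_power_0 list_pnorm_singleton[OF p])
next
  case (Suc m)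
  note ne = tuple_power_nonempty[OF T]
  have "list_pnorm p (\<lambda>B. N (B *v x)) (tuple_power T (Suc m)) \<le>
      list_pnorm p (\<lambda>B. R * N (B *v x)) (tuple_power T m)"
    unfolding list_pnorm_tuple_power_Suc[OF p T]
    by (intro list_pnorm_mono p ne step list_pnorm_nonneg T)
  also have "\<dots> = R * list_pnorm p (\<lambda>B. N (B *v x)) (tuple_power T m)"
    by (intro list_pnorm_scale p ne R)
  also have "\<dots> \<le> R * (R ^ m * N x)" by (intro mult_left_mono Suc R)
  finally show ?case by (simp add: mult.assoc)
qed

text \<open>
  On a joint eigenvector the product \<open>T\<^bsub>i\<^sub>1\<^esub> \<cdots> T\<^bsub>i\<^sub>m\<^esub>\<close> acts as \<open>\<mu>\<^bsub>i\<^sub>1\<^esub> \<cdots> \<mu>\<^bsub>i\<^sub>m\<^esub>\<close>, and the \<open>p\<close>-norm of all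
  these products is the \<open>m\<close>-th power of the \<open>p\<close>-norm of \<open>\<mu>\<close>.
\<close>

lemma tuple_power_eigenvector:
  assumes p: "1 \<le> p" and T: "T \<noteq> []" and eig: "\<And>A. A \<in> set T \<Longrightarrow> A *v x = \<mu> A *s x"
  shows "list_pnorm p (\<lambda>B. vec_pnorm p (B *v x)) (tuple_power T m) =
    list_pnorm p (\<lambda>A. cmod (\<mu> A)) T ^ m * vec_pnorm p x"
proof (induction m)
  case 0
  then show ?case by (simp add: tuple_power_0 list_pnorm_singleton[OF p] vec_pnorm_nonneg)
next
  case (Suc m)
  let ?r = "list_pnorm p (\<lambda>A. cmod (\<mu> A)) T"
  have scal: "\<exists>c. B *v x = c *s x" if "B \<in> set (tuple_power T k)" for B k
    using that
  proof (induction k arbitrary: B)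
    case 0
    then show ?case by (intro exI[of _ 1]) (simp add: tuple_power_0)
  next
    case (Suc k)
    then obtain A C where AC: "A \<in> set T" "C \<in> set (tuple_power T k)" "B = A ** C"
      by (auto simp: tuple_power_Suc)
    with Suc.IH obtain c where "C *v x = c *s x" by blast
    then have "B *v x = c *s (\<mu> A *s x)"
      using AC eig by (simp add: vector_scalar_commute flip: matrix_vector_mul_assoc)
    then show ?case by (auto simp: vector_smult_assoc)
  qed
  have step: "list_pnorm p (\<lambda>A. vec_pnorm p (A *v (B *v x))) T = ?r * vec_pnorm p (B *v x)"
    if B: "B \<in> set (tuple_power T m)" for B
  proof -
    obtain c where c: "B *v x = c *s x"
      using scal[OF B] by blast
    have "list_pnorm p (\<lambda>A. vec_pnorm p (A *v (B *v x))) T =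
        list_pnorm p (\<lambda>A. vec_pnorm p (B *v x) * cmod (\<mu> A)) T"
      by (rule list_pnorm_cong)
         (simp add: c eig vector_scalar_commute vec_pnorm_scale[OF p] vector_smult_assoc norm_mult mult_ac)
    also have "\<dots> = vec_pnorm p (B *v x) * ?r"
      by (rule list_pnorm_scale[OF p T vec_pnorm_nonneg])
    finally show ?thesis by (simp add: mult.commute)
  qed
  have "list_pnorm p (\<lambda>B. vec_pnorm p (B *v x)) (tuple_power T (Suc m)) =
      list_pnorm p (\<lambda>B. ?r * vec_pnorm p (B *v x)) (tuple_power T m)"
    unfolding list_pnorm_tuple_power_Suc[OF p T, of "vec_pnorm p"] by (rule list_pnorm_cong) (rule step)
  then show ?case
    by (simp add: list_pnorm_scale[OF p tuple_power_nonempty[OF T] list_pnorm_nonneg[OF T]] Suc)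
qed

section \<open>The joint point spectrum\<close>

lemma joint_point_spectrum_eq: "joint_point_spectrum T = {map \<mu> T | \<mu>. joint_weight (set T) \<mu>}"
proof (intro equalityI subsetI)
  fix l assume "l \<in> joint_point_spectrum T"
  then obtain x where len: "length l = length T" and x: "x \<noteq> 0"
    and eig: "\<And>i. i < length T \<Longrightarrow> T ! i *v x = l ! i *s x"
    by (auto simp: joint_point_spectrum_def)
  have "\<forall>A\<in>set T. \<exists>c. A *v x = c *s x" using eig by (metis in_set_conv_nth)
  then obtain \<mu> where \<mu>: "\<And>A. A \<in> set T \<Longrightarrow> A *v x = \<mu> A *s x" by metis
  have "l ! i = \<mu> (T ! i)" if "i < length T" for i
    using eig[OF that] \<mu>[of "T ! i"] that x by (metis nth_mem vec.scale_right_imp_eq)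
  then have "l = map \<mu> T" by (intro nth_equalityI) (auto simp: len)
  then show "l \<in> {map \<mu> T | \<mu>. joint_weight (set T) \<mu>}" using x \<mu> by (auto simp: joint_weight_def)
qed (auto simp: joint_point_spectrum_def joint_weight_def)

lemma finite_joint_point_spectrum: "finite (joint_point_spectrum T)"
proof -
  define E where "E = (\<Union>A\<in>set T. {\<mu>. \<exists>v. v \<noteq> 0 \<and> A *v v = \<mu> *s v})"
  have "finite E" unfolding E_def by (intro finite_UN_I finite_eigenvalues) auto
  moreover have "joint_point_spectrum T \<subseteq> {l. set l \<subseteq> E \<and> length l = length T}"
  proof
    fix l assume "l \<in> joint_point_spectrum T"
    then obtain \<mu> x where l: "l = map \<mu> T" and x: "x \<noteq> 0" "\<And>A. A \<in> set T \<Longrightarrow> A *v x = \<mu> A *s x"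
      by (auto simp: joint_point_spectrum_eq joint_weight_def)
    have "\<mu> A \<in> E" if "A \<in> set T" for A unfolding E_def using that x by blast
    then show "l \<in> {l. set l \<subseteq> E \<and> length l = length T}" by (auto simp: l)
  qed
  ultimately show ?thesis using finite_lists_length_eq finite_subset by blast
qed

lemma ex_joint_weight:
  assumes "descending_brackets (T :: (complex^'d^'d) list)"
  shows "\<exists>\<mu>. joint_weight (set T) \<mu>"
proof -
  have "\<not> (UNIV :: (complex^'d) set) \<subseteq> {0}"
  proof
    assume "(UNIV :: (complex^'d) set) \<subseteq> {0}"
    then have "(vec 1 :: complex^'d) = 0" by blast
    then show False by (simp add: vec_eq_iff)
  qed
  moreover have "invariant_subspace (set T) UNIV" "invariant_subspace (set T) {0}"
    by (simp_all add: invariant_subspace_def vec.subspace_single_0)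
  ultimately obtain v \<mu> where "v \<noteq> 0" "\<forall>A\<in>set T. A *v v - \<mu> A *s v = 0"
    using ex_weight_vector_mod[OF assms, of UNIV "{0}"] by auto
  then show ?thesis by (auto simp: joint_weight_def)
qed

section \<open>Comparison of the two spectral radii\<close>

text \<open>
  Work in coordinates \<open>y = Q z\<close> in which the tuple is diagonal up to \<open>\<epsilon>\<close>. The diagonal part sends \<open>y\<close> to a
  family with entries \<open>\<mu>\<^sup>(\<^sup>i\<^sup>)\<^sub>j y\<^sub>i\<close>; taking the norm over \<open>j\<close> first bounds it by \<open>r \<bar>y\<^sub>i\<bar>\<close>, hence the whole by
  \<open>r \<parallel>y\<parallel>\<close>. The remainder is at most \<open>\<epsilon> K \<parallel>y\<parallel>\<close> for a constant \<open>K\<close> that depends only on \<open>p\<close> and the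
  sizes, and \<open>\<epsilon>\<close> is chosen so that \<open>r + \<epsilon> K \<le> R\<close>.
\<close>

lemma ex_contracting_norm:
  fixes T :: "(complex^'d^'d) list"
  assumes p: "1 \<le> p" and ne: "T \<noteq> []" and T: "descending_brackets T"
    and r: "\<And>\<mu>. joint_weight (set T) \<mu> \<Longrightarrow> list_pnorm p (\<lambda>A. cmod (\<mu> A)) T \<le> r"
    and R: "r < R"
  obtains P Q :: "complex^'d^'d" where "P ** Q = mat 1"
    "\<And>z. list_pnorm p (\<lambda>A. vec_pnorm p (Q *v (A *v z))) T \<le> R * vec_pnorm p (Q *v z)"
proof -
  let ?I = "{..<length T}" and ?d = "real CARD('d)"
  have I: "finite ?I" "?I \<noteq> {}" using ne by auto
  have U: "finite (UNIV :: 'd set)" "(UNIV :: 'd set) \<noteq> {}" by auto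
  define K where "K = pnorm p ?I (\<lambda>_. pnorm p (UNIV :: 'd set) (\<lambda>_. ?d))"
  have K: "0 \<le> K" unfolding K_def by (rule pnorm_nonneg[OF I])
  \<comment> \<open>The \<open>1\<close> in the denominator only prevents a division by zero.\<close>
  define \<epsilon> where "\<epsilon> = (R - r) / (K + 1)"
  have \<epsilon>: "\<epsilon> > 0" "\<epsilon> * K \<le> R - r" using K R by (auto simp: \<epsilon>_def field_simps)
  obtain P Q :: "complex^'d^'d" and l where PQ: "P ** Q = mat 1"
    and wt: "\<And>k. joint_weight (set T) (l k)"
    and close: "\<And>A i k. A \<in> set T \<Longrightarrow> cmod ((Q ** A ** P) $ i $ k - (if i = k then l k A else 0)) \<le> \<epsilon>"
    by (rule ex_almost_diagonalisation[OF T \<epsilon>(1)]) blast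
  have "list_pnorm p (\<lambda>A. vec_pnorm p (Q *v (A *v z))) T \<le> R * vec_pnorm p (Q *v z)" for z
  proof -
    define y where "y = Q *v z"
    have z: "z = P *v y" by (simp add: y_def matrix_vector_mul_assoc PQ)
    let ?y = "vec_pnorm p y"
    define a where "a = (\<lambda>j i. cmod (y $ i) * cmod (l i (T ! j)))"
    define b where "b = \<epsilon> * ?y"
    have a0: "0 \<le> a j i" for i j by (simp add: a_def)
    have b0: "0 \<le> b" using \<epsilon> by (simp add: b_def vec_pnorm_nonneg)
    have entry: "cmod ((Q *v (T ! j *v z)) $ i) \<le> a j i + b * ?d" if j: "j \<in> ?I" for i j
    proof -
      let ?M = "Q ** (T ! j) ** P"
      let ?D = "\<lambda>k. if i = k then l k (T ! j) else 0"
      have "(Q *v (T ! j *v z)) $ i = (\<Sum>k\<in>UNIV. ?M $ i $ k * y $ k)"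
        unfolding z by (simp add: matrix_vector_mul_assoc matrix_mul_assoc) (simp add: matrix_vector_mult_def)
      also have "\<dots> = (\<Sum>k\<in>UNIV. ?D k * y $ k) + (\<Sum>k\<in>UNIV. (?M $ i $ k - ?D k) * y $ k)"
        by (simp add: algebra_simps flip: sum.distrib)
      also have "(\<Sum>k\<in>UNIV. ?D k * y $ k) = l i (T ! j) * y $ i"
        by (simp add: if_distrib[of "\<lambda>c. c * _"] cong: if_cong)
      finally have "cmod ((Q *v (T ! j *v z)) $ i) \<le>
          a j i + cmod (\<Sum>k\<in>UNIV. (?M $ i $ k - ?D k) * y $ k)"
        using norm_triangle_ineq[of "l i (T ! j) * y $ i" "\<Sum>k\<in>UNIV. (?M $ i $ k - ?D k) * y $ k"]
        by (simp only: a_def norm_mult mult.commute)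
      moreover have "cmod (\<Sum>k\<in>UNIV. (?M $ i $ k - ?D k) * y $ k) \<le> (\<Sum>k\<in>(UNIV::'d set). b)"
        unfolding b_def
      proof (rule sum_norm_le)
        fix k
        show "cmod ((?M $ i $ k - ?D k) * y $ k) \<le> \<epsilon> * ?y"
          unfolding norm_mult using close[of "T ! j" i k] j \<epsilon>(1)
          by (intro mult_mono component_le_vec_pnorm[OF p]) auto
      qed
      ultimately show ?thesis by (simp add: mult.commute)
    qed
    have "list_pnorm p (\<lambda>A. vec_pnorm p (Q *v (A *v z))) T =
        pnorm p ?I (\<lambda>j. pnorm p UNIV (\<lambda>i. cmod ((Q *v (T ! j *v z)) $ i)))"
      by (simp add: list_pnorm_def vec_pnorm_norm)
    also have "\<dots> \<le> pnorm p ?I (\<lambda>j. pnorm p UNIV (a j) + b * pnorm p (UNIV :: 'd set) (\<lambda>_. ?d))"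
    proof (rule pnorm_mono[OF p I])
      fix j assume j: "j \<in> ?I"
      have "pnorm p UNIV (\<lambda>i. cmod ((Q *v (T ! j *v z)) $ i)) \<le> pnorm p UNIV (\<lambda>i. a j i + b * ?d)"
        using entry[OF j] a0 b0 by (intro pnorm_mono[OF p U]) (auto simp: abs_of_nonneg)
      also have "\<dots> \<le> pnorm p UNIV (a j) + pnorm p (UNIV :: 'd set) (\<lambda>_. b * ?d)"
        using a0 b0 by (intro pnorm_triangle[OF p U]) auto
      also have "pnorm p (UNIV :: 'd set) (\<lambda>_. b * ?d) = b * pnorm p (UNIV :: 'd set) (\<lambda>_. ?d)"
        by (rule pnorm_scale[OF p U b0])
      finally show "norm (pnorm p UNIV (\<lambda>i. cmod ((Q *v (T ! j *v z)) $ i))) \<le>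
          norm (pnorm p UNIV (a j) + b * pnorm p (UNIV :: 'd set) (\<lambda>_. ?d))"
        using pnorm_nonneg[OF U, of p "\<lambda>i. cmod ((Q *v (T ! j *v z)) $ i)"] by simp
    qed
    also have "\<dots> \<le> pnorm p ?I (\<lambda>j. pnorm p UNIV (a j)) +
        pnorm p ?I (\<lambda>j. b * pnorm p (UNIV :: 'd set) (\<lambda>_. ?d))"
      using b0 by (intro pnorm_triangle[OF p I] mult_nonneg_nonneg pnorm_nonneg[OF U])
    also have "pnorm p ?I (\<lambda>j. b * pnorm p (UNIV :: 'd set) (\<lambda>_. ?d)) = b * K"
      unfolding K_def by (rule pnorm_scale[OF p I b0])
    also have "pnorm p ?I (\<lambda>j. pnorm p UNIV (a j)) = pnorm p UNIV (\<lambda>i. pnorm p ?I (\<lambda>j. a j i))"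
      by (rule pnorm_swap[OF p I U])
    also have "\<dots> \<le> r * ?y"
    proof -
      have "pnorm p ?I (\<lambda>j. a j i) \<le> cmod (y $ i) * r" for i
      proof -
        have "pnorm p ?I (\<lambda>j. a j i) = cmod (y $ i) * list_pnorm p (\<lambda>A. cmod (l i A)) T"
          unfolding a_def list_pnorm_def by (rule pnorm_scale[OF p I]) simp
        also have "\<dots> \<le> cmod (y $ i) * r" by (intro mult_left_mono r wt) simp
        finally show ?thesis .
      qed
      moreover have r0: "0 \<le> r" using r[OF wt] list_pnorm_nonneg[OF ne] order_trans by blast
      ultimately have "pnorm p UNIV (\<lambda>i. pnorm p ?I (\<lambda>j. a j i)) \<le> pnorm p UNIV (\<lambda>i. r * cmod (y $ i))"
        using pnorm_nonneg[OF I, of p "\<lambda>j. a j _"]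
        by (intro pnorm_mono[OF p U]) (simp add: mult.commute abs_mult)
      also have "\<dots> = r * ?y" unfolding vec_pnorm_norm by (rule pnorm_scale[OF p U r0])
      finally show ?thesis .
    qed
    finally have "list_pnorm p (\<lambda>A. vec_pnorm p (Q *v (A *v z))) T \<le> (r + \<epsilon> * K) * ?y"
      by (simp add: b_def algebra_simps)
    also have "\<dots> \<le> R * ?y" using \<epsilon>(2) by (intro mult_right_mono vec_pnorm_nonneg) simp
    finally show ?thesis by (simp add: y_def)
  qed
  then show ?thesis using that[OF PQ] by blast
qed

lemma op_pnorm_tuple_power_growth:
  fixes T :: "(complex^'d^'d) list"
  assumes p: "1 \<le> p" and ne: "T \<noteq> []" and T: "descending_brackets T"
    and r: "\<And>\<mu>. joint_weight (set T) \<mu> \<Longrightarrow> list_pnorm p (\<lambda>A. cmod (\<mu> A)) T \<le> r"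
    and R: "r < R" "0 \<le> R"
  shows "\<exists>C>0. \<forall>m. op_pnorm p (tuple_power T m) \<le> C * R ^ m"
proof -
  obtain P Q :: "complex^'d^'d" where PQ: "P ** Q = mat 1"
    and contr: "\<And>z. list_pnorm p (\<lambda>A. vec_pnorm p (Q *v (A *v z))) T \<le> R * vec_pnorm p (Q *v z)"
    using ex_contracting_norm[OF p ne T r R(1)] by blast
  obtain a where a: "0 < a" "\<And>x. vec_pnorm p (P *v x) \<le> a * vec_pnorm p x"
    using ex_vec_pnorm_bound[OF p] by blast
  obtain b where b: "0 < b" "\<And>x. vec_pnorm p (Q *v x) \<le> b * vec_pnorm p x"
    using ex_vec_pnorm_bound[OF p] by blast
  have "op_pnorm p (tuple_power T m) \<le> a * b * R ^ m" for m
  proof (rule op_pnorm_leI[OF p])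
    fix x :: "complex^'d" assume x: "vec_pnorm p x \<le> 1"
    note nem = tuple_power_nonempty[OF ne]
    have "list_pnorm p (\<lambda>B. vec_pnorm p (B *v x)) (tuple_power T m) \<le>
        list_pnorm p (\<lambda>B. a * vec_pnorm p (Q *v (B *v x))) (tuple_power T m)"
    proof (rule list_pnorm_mono[OF p nem vec_pnorm_nonneg])
      fix B :: "complex^'d^'d"
      show "vec_pnorm p (B *v x) \<le> a * vec_pnorm p (Q *v (B *v x))"
        using a(2)[of "Q *v (B *v x)"] by (simp add: matrix_vector_mul_assoc matrix_mul_assoc PQ)
    qed
    also have "\<dots> = a * list_pnorm p (\<lambda>B. vec_pnorm p (Q *v (B *v x))) (tuple_power T m)"
      using a(1) by (intro list_pnorm_scale[OF p nem]) simp
    also have "\<dots> \<le> a * (R ^ m * vec_pnorm p (Q *v x))"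
      using a(1) by (intro mult_left_mono tuple_power_growth_le[OF p ne vec_pnorm_nonneg R(2) contr]) simp
    also have "\<dots> \<le> a * (R ^ m * (b * 1))"
    proof -
      have "vec_pnorm p (Q *v x) \<le> b * vec_pnorm p x" by (rule b(2))
      also have "\<dots> \<le> b * 1" using b(1) x by (intro mult_left_mono) auto
      finally show ?thesis using a(1) R(2) by (intro mult_left_mono) auto
    qed
    finally show "list_pnorm p (\<lambda>B. vec_pnorm p (B *v x)) (tuple_power T m) \<le> a * b * R ^ m"
      by (simp add: mult_ac)
  qed
  then show ?thesis using a(1) b(1) by (intro exI[of _ "a * b"]) auto
qed

theorem spectral_radii_eq:
  fixes T :: "(complex^'d^'d) list"
  assumes p: "1 \<le> p" and ne: "T \<noteq> []" and T: "descending_brackets T"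
  shows "algebraic_spectral_radius p T = geometric_spectral_radius p T"
proof -
  define r where "r = geometric_spectral_radius p T"
  note ne_m = tuple_power_nonempty[OF ne]
  have tp: "tuple_pnorm p (map \<mu> T) = list_pnorm p (\<lambda>A. cmod (\<mu> A)) T" for \<mu>
    unfolding tuple_pnorm_def list_pnorm_def length_map by (rule pnorm_cong) simp
  have fin: "finite (tuple_pnorm p ` joint_point_spectrum T)"
    using finite_joint_point_spectrum by blast
  have r_ge: "list_pnorm p (\<lambda>A. cmod (\<mu> A)) T \<le> r" if "joint_weight (set T) \<mu>" for \<mu>
    unfolding r_def geometric_spectral_radius_def tp[symmetric]
    using that fin by (intro Max_ge) (auto simp: joint_point_spectrum_eq)
  have "joint_point_spectrum T \<noteq> {}"
    using ex_joint_weight[OF T] by (auto simp: joint_point_spectrum_eq)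
  then have "r \<in> tuple_pnorm p ` joint_point_spectrum T"
    unfolding r_def geometric_spectral_radius_def by (intro Max_in fin) auto
  then obtain \<mu> where \<mu>: "joint_weight (set T) \<mu>" "r = list_pnorm p (\<lambda>A. cmod (\<mu> A)) T"
    by (auto simp: joint_point_spectrum_eq tp)
  then have r0: "0 \<le> r" using list_pnorm_nonneg[OF ne] by simp
  let ?f = "\<lambda>m. root m (op_pnorm p (tuple_power T m))"
  have f0: "0 \<le> ?f m" if "m \<ge> 1" for m
    using that op_pnorm_nonneg[OF p ne_m] by (simp add: real_root_pos_pos_le)
  have "r \<le> algebraic_spectral_radius p T"
    unfolding algebraic_spectral_radius_def
  proof (rule cINF_greatest)
    fix m :: nat assume m: "m \<in> {1..}"
    obtain x0 where x0: "x0 \<noteq> 0" "\<And>A. A \<in> set T \<Longrightarrow> A *v x0 = \<mu> A *s x0"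
      using \<mu>(1) by (auto simp: joint_weight_def)
    \<comment> \<open>The eigenvector is normalised so that it is admissible in the supremum.\<close>
    define c where "c = complex_of_real (inverse (vec_pnorm p x0))"
    define x where "x = c *s x0"
    have pos: "0 < vec_pnorm p x0" using vec_pnorm_pos[OF p x0(1)] .
    then have x: "vec_pnorm p x = 1" by (simp add: x_def c_def vec_pnorm_scale[OF p] norm_inverse)
    have eig: "A *v x = \<mu> A *s x" if "A \<in> set T" for A
      using x0(2)[OF that] by (simp add: x_def vector_scalar_commute vector_smult_assoc mult.commute)
    have "r ^ m = list_pnorm p (\<lambda>B. vec_pnorm p (B *v x)) (tuple_power T m)"
      using tuple_power_eigenvector[OF p ne eig, of m] x \<mu>(2) by simp
    also have "\<dots> \<le> op_pnorm p (tuple_power T m)"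
      using x by (intro list_pnorm_le_op_pnorm[OF p ne_m]) simp
    finally have "root m (r ^ m) \<le> ?f m" using m by (intro real_root_le_mono) auto
    then show "r \<le> ?f m" using m r0 by (simp add: real_root_power_cancel)
  qed simp
  moreover have "algebraic_spectral_radius p T \<le> r"
  proof (rule dense_ge)
    fix R assume R: "r < R"
    obtain C where C: "C > 0" "\<And>m. op_pnorm p (tuple_power T m) \<le> C * R ^ m"
      using op_pnorm_tuple_power_growth[OF p ne T r_ge R] R r0 by auto
    have le: "algebraic_spectral_radius p T \<le> root m C * R" if m: "m \<ge> 1" for m
    proof -
      have "algebraic_spectral_radius p T \<le> ?f m"
        unfolding algebraic_spectral_radius_def
        by (rule cINF_lower) (use m f0 in \<open>auto intro!: bdd_belowI2[of _ 0]\<close>)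
      also have "\<dots> \<le> root m (C * R ^ m)" using m C(2) by (intro real_root_le_mono) auto
      also have "\<dots> = root m C * R"
        using m R r0 by (simp add: real_root_mult real_root_power_cancel)
      finally show ?thesis .
    qed
    have "(\<lambda>m. root m C * R) \<longlonglongrightarrow> 1 * R" by (intro tendsto_intros LIMSEQ_root_const C)
    then show "algebraic_spectral_radius p T \<le> R"
      using le by (intro LIMSEQ_le_const[of _ "R"]) auto
  qed
  ultimately show ?thesis by (simp add: r_def)
qed

text \<open>
  Counting list positions from \<open>0\<close>, \<open>xs ! i\<close> lies in \<open>F (i + 1)\<close>, so the bracket condition of the series
  puts the bracket into \<open>F i\<close>, which is spanned by the first \<open>i\<close> entries. The opposite product only
  changes its sign.
\<close>

lemma jordan_hoelder_basis_descending_brackets: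
  assumes "jordan_hoelder_basis n L xs"
  shows "descending_brackets xs"
  unfolding descending_brackets_def
proof (intro allI impI, elim conjE)
  fix i j assume ij: "i < j" "j < length xs"
  from assms obtain F where len: "length xs = n" and F: "jordan_hoelder_series n L F"
    and basis: "\<And>k. k \<le> n \<Longrightarrow> cmat.span (set (take k xs)) = F k"
    by (auto simp: jordan_hoelder_basis_def is_basis_def)
  have mem: "xs ! k \<in> F (Suc k)" if "k < n" for k
  proof -
    have "xs ! k \<in> set (take (Suc k) xs)" using that len by (simp add: take_Suc_conv_app_nth)
    then show ?thesis using that basis[of "Suc k"] cmat.span_base by auto
  qed
  have "bracket_span (F (Suc i)) (F (Suc j)) \<subseteq> F i"
  proof -
    have "\<forall>i j. 1 \<le> i \<and> i < j \<and> j \<le> n \<longrightarrow> bracket_span (F i) (F j) \<subseteq> F (i - 1)"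
      using F unfolding jordan_hoelder_series_def by (elim conjE)
    from this[rule_format, of "Suc i" "Suc j"] show ?thesis using ij len by simp
  qed
  moreover have "op_bracket (xs ! i) (xs ! j) \<in> bracket_span (F (Suc i)) (F (Suc j))"
  proof -
    have "xs ! i \<in> F (Suc i)" "xs ! j \<in> F (Suc j)" using mem ij len by auto
    then show ?thesis unfolding bracket_span_def by (intro cmat.span_base) blast
  qed
  ultimately have "op_bracket (xs ! i) (xs ! j) \<in> cmat.span (set (take i xs))"
    using basis[of i] ij len by auto
  then have "- op_bracket (xs ! i) (xs ! j) \<in> cmat.span (set (take i xs))" by (rule cmat.span_neg)
  then show "xs ! i ** xs ! j - xs ! j ** xs ! i \<in> cmat.span (set (take i xs))"
    by (simp add: op_bracket_def op_mult_def)
qed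

theorem theorem3p4:
  fixes n :: nat and p :: ennreal
  assumes "1 \<le> n" and "1 \<le> p"
  shows "(\<forall>(L :: (complex^'d^'d) set) xs.
            lie_subalgebra L \<and> cmat.dim L = n \<and> lie_nilpotent L \<and> jordan_hoelder_basis n L xs \<longrightarrow>
            algebraic_spectral_radius p xs = geometric_spectral_radius p xs) \<and>
         (\<forall>T :: (complex^'d^'d) list.
            length T = n \<and> (\<forall>i<n. \<forall>j<n. T ! i ** T ! j = T ! j ** T ! i) \<longrightarrow>
            algebraic_spectral_radius p T = geometric_spectral_radius p T)"
proof (intro conjI allI impI; elim conjE)
  fix L :: "(complex^'d^'d) set" and xs
  assume "jordan_hoelder_basis n L xs"
  then show "algebraic_spectral_radius p xs = geometric_spectral_radius p xs"
    using assms jordan_hoelder_basis_descending_brackets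
    by (intro spectral_radii_eq) (auto simp: jordan_hoelder_basis_def)
next
  fix T :: "(complex^'d^'d) list"
  assume T: "length T = n" "\<forall>i<n. \<forall>j<n. T ! i ** T ! j = T ! j ** T ! i"
  then have "descending_brackets T" by (simp add: descending_brackets_def cmat.span_zero)
  then show "algebraic_spectral_radius p T = geometric_spectral_radius p T"
    using assms T by (intro spectral_radii_eq) auto
qed

end
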